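(* Let $T$ be an interval exchange map of $d=3$ intervals with admissible combinatorial data, with the Keane property, and with total length $\lambda^*=1$. Then the following three conditions are equivalent: (Z) for every $\varepsilon>0$ there is $C_\varepsilon>0$ such that $\|Z(k,k+1)\|\le C_\varepsilon\|Z(k)\|^{\varepsilon}$ for all $k\ge1$; (U) $\lim_{r\to0^+}\frac{\log\tau_r(x)}{-\log r}=1$ uniformly in $x\in[0,1)$; (R) $\lim_{r\to0^+}\frac{\log\tau_r(x)}{-\log r}=1$ for Lebesgue almost every $x\in[0,1)$.
   Context: Interval exchange maps. Let $\mathcal A$ be an alphabet with $d$ letters. Combinatorial data is a pair $\pi=(\pi_t,\pi_b)$ of bijections $\mathcal A\to\{1,\dots,d\}$; it is admissible if $\pi_t^{-1}(\{1,\dots,k\})\ne\pi_b^{-1}(\{1,\dots,k\})$ for $k=1,\dots,d-1$. Length data is a vector $(\lambda_\alpha)_{\alpha\in\mathcal A}$ of positive reals; $\lambda^*=\sum_\alpha\lambda_\alpha$, $I=[0,\lambda^* )$, $p_\alpha=\sum_{\pi_t(\beta)<\pi_t(\alpha)}\lambda_\beta$, $I_\alpha=[p_\alpha,p_\alpha+\lambda_\alpha)$. The map is $T(x)=x+\sum_{\pi_b(\beta)<\pi_b(\alpha)}\lambda_\beta-\sum_{\pi_t(\beta)<\pi_t(\alpha)}\lambda_\beta$ for $x\in I_\alpha$. Keane property: there are no $\alpha,\beta\in\mathcal A$ and $m\ge1$ with $T^m(p_\alpha)=p_\beta$ and $\pi_t(\beta)>1$. Return time. $\tau_r(x)=\min\{j\ge1:\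 |T^jx-x|<r\}$ for $r>0$, $x\in I$. Rauzy–Veech algorithm. Let $\alpha_t,\alpha_b$ be the letters with $\pi_t(\alpha_t)=\pi_b(\alpha_b)=d$. If $\lambda_{\alpha_t}>\lambda_{\alpha_b}$ (top type) the winner is $\alpha_t$ and the loser $\alpha_b$; the new data keep $\pi_t$, and in the order given by $\pi_b$ the letter $\alpha_b$ is moved to the position immediately after $\alpha_t$. If $\lambda_{\alpha_b}>\lambda_{\alpha_t}$ (bottom type) the winner is $\alpha_b$ and the loser $\alpha_t$; the new data keep $\pi_b$, and in the order given by $\pi_t$ the letter $\alpha_t$ is moved to the position immediately after $\alpha_b$. In both cases the winner's length is replaced by (winner's length minus loser's length) and all other lengths are kept. The new map $\mathcal V(T)$ is the first return map of $T$ to $[0,\sum_\alpha\hat\lambda_\alpha)$, where $\hat\lambda$ is the new length vector. For $T$ admissible with the Keane property this can be iterated forever; $T(n)=\mathcal V^n(T)$. Write $\gamma(m,n)$ for the sequence of steps (arrows) from $T(m)$ to $T(n)$. For a step with winner $\alpha$ and loser $\beta$ put $B=\mathbb I+E_{\beta\alpha}$ ($E_{\beta\alpha}$ has its only nonzero entry, a $1$, in row $\beta$, column $\alpha$); $Q(m,n)$ is the product of the matrices of the steps of $\gamma(m,n)$, later steps on the left. The norm $\|\cdot\|$ of a matrix is the sum of the absolute values of its entries. Zorich acceleration. $n_0=0$ and $n_{k+1}>n_k$ is the largest integer such that all steps in $\gamma(n_k,n_{k+1})$ have the same winner. $Z(k)=Q(0,n_k)$, $Z(k,\ell)=Q(n_k,n_\ell)$.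 *)

theory Defs
  imports "HOL-Analysis.Analysis"
begin

section \<open>Interval exchange maps\<close>

text \<open>The alphabet is a finite type \<open>'a\<close>, so \<open>d = CARD('a)\<close>; positions are numbered
  \<open>1, \<dots>, d\<close>.\<close>

record 'a iet_data =
  top_pos :: "'a \<Rightarrow> nat"
  bot_pos :: "'a \<Rightarrow> nat"
  len :: "'a \<Rightarrow> real"

definition iet_data :: "'a::finite iet_data \<Rightarrow> bool" where
  "iet_data D \<longleftrightarrow>
     bij_betw (top_pos D) UNIV {1..CARD('a)} \<and>
     bij_betw (bot_pos D) UNIV {1..CARD('a)} \<and>
     (\<forall>a. len D a > 0)"

definition admissible :: "'a::finite iet_data \<Rightarrow> bool" where
  "admissible D \<longleftrightarrow>
     (\<forall>k. 1 \<le> k \<and> k \<le> CARD('a) - 1 \<longrightarrow> top_pos D -` {1..k} \<noteq> bot_pos D -` {1..k})"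

definition total_len :: "'a::finite iet_data \<Rightarrow> real" where
  "total_len D = (\<Sum>a\<in>UNIV. len D a)"

definition top_left :: "'a::finite iet_data \<Rightarrow> 'a \<Rightarrow> real" where
  "top_left D a = (\<Sum>b | top_pos D b < top_pos D a. len D b)"

definition bot_left :: "'a::finite iet_data \<Rightarrow> 'a \<Rightarrow> real" where
  "bot_left D a = (\<Sum>b | bot_pos D b < bot_pos D a. len D b)"

definition top_interval :: "'a::finite iet_data \<Rightarrow> 'a \<Rightarrow> real set" where
  "top_interval D a = {top_left D a ..< top_left D a + len D a}"

text \<open>Only meaningful on \<open>{0..<total_len D}\<close>, which the map sends to itself.\<close>

definition iet :: "'a::finite iet_data \<Rightarrow> real \<Rightarrow> real" where
  "iet D x = (let a = (THE a. x \<in> top_interval D a) in x + bot_left D a - top_left D a)"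

definition keane :: "'a::finite iet_data \<Rightarrow> bool" where
  "keane D \<longleftrightarrow>
     \<not> (\<exists>a b m. m \<ge> 1 \<and> (iet D ^^ m) (top_left D a) = top_left D b \<and> top_pos D b > 1)"

text \<open>The set of return times is nonempty whenever the data are admissible with the Keane
  property, since the map is then minimal.\<close>

definition return_time :: "'a::finite iet_data \<Rightarrow> real \<Rightarrow> real \<Rightarrow> nat" where
  "return_time D r x = (LEAST j. j \<ge> 1 \<and> \<bar>(iet D ^^ j) x - x\<bar> < r)"

definition log_return_ratio :: "'a::finite iet_data \<Rightarrow> real \<Rightarrow> real \<Rightarrow> real" where
  "log_return_ratio D r x = ln (real (return_time D r x)) / (- ln r)"


section \<open>Rauzy--Veech algorithm\<close>

definition last_top :: "'a::finite iet_data \<Rightarrow> 'a" where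
  "last_top D = (THE a. top_pos D a = CARD('a))"

definition last_bot :: "'a::finite iet_data \<Rightarrow> 'a" where
  "last_bot D = (THE a. bot_pos D a = CARD('a))"

text \<open>When \<open>top_type\<close> fails the step is treated as one of bottom type; equality of the two
  lengths never occurs along the orbit of admissible data with the Keane property.\<close>

definition top_type :: "'a::finite iet_data \<Rightarrow> bool" where
  "top_type D \<longleftrightarrow> len D (last_top D) > len D (last_bot D)"

definition winner :: "'a::finite iet_data \<Rightarrow> 'a" where
  "winner D = (if top_type D then last_top D else last_bot D)"

definition loser :: "'a::finite iet_data \<Rightarrow> 'a" where
  "loser D = (if top_type D then last_bot D else last_top D)"

text \<open>Move the letter \<open>l\<close>, which is last in the order given by \<open>p\<close>, to the position immediately
  after \<open>w\<close>.\<close>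

definition move_after :: "'a \<Rightarrow> 'a \<Rightarrow> ('a \<Rightarrow> nat) \<Rightarrow> 'a \<Rightarrow> nat" where
  "move_after w l p a =
     (if a = l then p w + 1 else if p a \<le> p w then p a else p a + 1)"

definition rauzy_step :: "'a::finite iet_data \<Rightarrow> 'a iet_data" where
  "rauzy_step D =
     \<lparr> top_pos = (if top_type D then top_pos D
                  else move_after (winner D) (loser D) (top_pos D)),
       bot_pos = (if top_type D then move_after (winner D) (loser D) (bot_pos D)
                  else bot_pos D),
       len = (len D)(winner D := len D (winner D) - len D (loser D)) \<rparr>"

definition rauzy_iter :: "'a::finite iet_data \<Rightarrow> nat \<Rightarrow> 'a iet_data" where
  "rauzy_iter D n = (rauzy_step ^^ n) D"

definition unit_matrix :: "'a::finite \<Rightarrow> 'a \<Rightarrow> real^'a^'a" where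
  "unit_matrix b a = (\<chi> i j. if i = b \<and> j = a then 1 else 0)"

definition step_matrix :: "'a::finite iet_data \<Rightarrow> real^'a^'a" where
  "step_matrix D = mat 1 + unit_matrix (loser D) (winner D)"

text \<open>\<open>Q_matrix D m n\<close> is \<open>Q(m,n)\<close> for \<open>m \<le> n\<close>.\<close>

primrec Q_matrix :: "'a::finite iet_data \<Rightarrow> nat \<Rightarrow> nat \<Rightarrow> real^'a^'a" where
  "Q_matrix D m 0 = mat 1"
| "Q_matrix D m (Suc n) =
     (if m \<le> n then step_matrix (rauzy_iter D n) ** Q_matrix D m n else mat 1)"

definition matrix_norm :: "real^'a^'a \<Rightarrow> real" where
  "matrix_norm A = (\<Sum>i\<in>UNIV. \<Sum>j\<in>UNIV. \<bar>A $ i $ j\<bar>)"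


section \<open>Zorich acceleration\<close>

definition same_winner :: "'a::finite iet_data \<Rightarrow> nat \<Rightarrow> nat \<Rightarrow> bool" where
  "same_winner D m n \<longleftrightarrow>
     (\<forall>i\<in>{m..<n}. \<forall>j\<in>{m..<n}. winner (rauzy_iter D i) = winner (rauzy_iter D j))"

text \<open>The greatest \<open>n\<close> exists for admissible data with the Keane property, since no letter
  then wins all steps from some time on.\<close>

primrec zorich_time :: "'a::finite iet_data \<Rightarrow> nat \<Rightarrow> nat" where
  "zorich_time D 0 = 0"
| "zorich_time D (Suc k) =
     (GREATEST n. n > zorich_time D k \<and> same_winner D (zorich_time D k) n)"

definition Z_matrix :: "'a::finite iet_data \<Rightarrow> nat \<Rightarrow> nat \<Rightarrow> real^'a^'a" where
  "Z_matrix D k l = Q_matrix D (zorich_time D k) (zorich_time D l)"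


section \<open>The three conditions\<close>

definition condition_Z :: "'a::finite iet_data \<Rightarrow> bool" where
  "condition_Z D \<longleftrightarrow>
     (\<forall>\<epsilon>>0. \<exists>C>0. \<forall>k\<ge>1.
        matrix_norm (Z_matrix D k (k + 1)) \<le> C * matrix_norm (Z_matrix D 0 k) powr \<epsilon>)"

definition condition_U :: "'a::finite iet_data \<Rightarrow> bool" where
  "condition_U D \<longleftrightarrow>
     uniform_limit {0..<total_len D} (log_return_ratio D) (\<lambda>x. 1) (at_right 0)"

definition condition_R :: "'a::finite iet_data \<Rightarrow> bool" where
  "condition_R D \<longleftrightarrow>
     (AE x in lebesgue_on {0..<total_len D}.
        ((\<lambda>r. log_return_ratio D r x) \<longlongrightarrow> 1) (at_right 0))"

end

theory Submission
  imports Defs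
begin

text \<open>An admissible exchange of three intervals is a rotation by some \<open>\<beta>\<close> on a circle of length \<open>L\<close>, or
  a first return map of one. If \<open>x\<close> is the displacement to the right of the first top letter and \<open>y\<close> the
  displacement to the left of the first bottom letter, then a Rauzy--Veech step either subtracts the
  smaller of \<open>x, y\<close> from the larger one or leaves both unchanged, and the latter never happens twice in
  a row. So the algorithm is the slow continued fraction algorithm of \<open>\<beta> / L\<close>: with \<open>hu, hv\<close>
  the return times belonging to \<open>x, y\<close> one has \<open>hu * y + hv * x = L\<close>, and \<open>N = hu + hv\<close>
  is comparable with the norm of \<open>Q(0, n)\<close>. Steps with the same winner are steps of the same
  type, so Zorich blocks are runs of one type and \<open>\<parallel>Z(k, k + 1)\<parallel>\<close> is 3 plus the length of the run.

  Any four consecutive blocks contain a subtraction of either kind. Hence \<open>x\<close> and \<open>y\<close> at time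
  \<open>n\<^sub>k\<close> are at least \<open>L / N\<close> taken four blocks later, and at most \<open>L / N\<close> taken four blocks earlier.
  Since no return closer than \<open>min x y\<close> occurs before time \<open>N / 2\<close>, and a return closer than any \<open>r > max x y\<close>
  occurs before time \<open>N\<close>, condition (Z) pins down all return times. Conversely, in front of a
  long run the smaller displacement, say \<open>y\<close>, is much smaller than \<open>1 / hv\<close>, and every point to the
  right of \<open>y\<close> returns within distance \<open>y\<close> by time \<open>hv\<close>; so a failure of (Z) destroys the
  limit at every interior point.\<close>

section \<open>Shapes of three-interval exchanges\<close>

datatype shape = Flip | TailFirst | HeadLast

text \<open>The three admissible bottom rows below the top row \<open>a b c\<close>: \<open>c b a\<close>, \<open>c a b\<close> and \<open>b c a\<close>.\<close>

definition has_shape :: "shape \<Rightarrow> 'a::finite iet_data \<Rightarrow> 'a \<Rightarrow> 'a \<Rightarrow> 'a \<Rightarrow> bool" where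
  "has_shape s D a b c \<longleftrightarrow>
     (\<forall>e. e = a \<or> e = b \<or> e = c) \<and> a \<noteq> b \<and> a \<noteq> c \<and> b \<noteq> c \<and>
     len D a > 0 \<and> len D b > 0 \<and> len D c > 0 \<and>
     top_pos D a = 1 \<and> top_pos D b = 2 \<and> top_pos D c = 3 \<and>
     (case s of
        Flip \<Rightarrow> bot_pos D c = 1 \<and> bot_pos D b = 2 \<and> bot_pos D a = 3
      | TailFirst \<Rightarrow> bot_pos D c = 1 \<and> bot_pos D a = 2 \<and> bot_pos D b = 3
      | HeadLast \<Rightarrow> bot_pos D b = 1 \<and> bot_pos D c = 2 \<and> bot_pos D a = 3)"

definition bot_last :: "shape \<Rightarrow> 'a \<Rightarrow> 'a \<Rightarrow> 'a" where
  "bot_last s a b = (if s = TailFirst then b else a)"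

lemma has_shape_univ: "has_shape s D a b c \<Longrightarrow> e = a \<or> e = b \<or> e = c"
  unfolding has_shape_def by blast

lemma has_shapeD:
  assumes "has_shape s D a b c"
  shows "a \<noteq> b" "a \<noteq> c" "b \<noteq> c" "b \<noteq> a" "c \<noteq> a" "c \<noteq> b"
    "len D a > 0" "len D b > 0" "len D c > 0"
    "top_pos D a = 1" "top_pos D b = 2" "top_pos D c = 3"
    "bot_pos D a = (if s = TailFirst then 2 else 3)"
    "bot_pos D b = (if s = Flip then 2 else if s = TailFirst then 3 else 1)"
    "bot_pos D c = (if s = HeadLast then 2 else 1)"
proof -
  have *: "a \<noteq> b \<and> a \<noteq> c \<and> b \<noteq> c"
      "len D a > 0 \<and> len D b > 0 \<and> len D c > 0"
      "top_pos D a = 1 \<and> top_pos D b = 2 \<and> top_pos D c = 3"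
    using assms unfolding has_shape_def by blast+
  from *(1) show "a \<noteq> b" "a \<noteq> c" "b \<noteq> c" "b \<noteq> a" "c \<noteq> a" "c \<noteq> b"
    by auto
  from *(2,3) show "len D a > 0" "len D b > 0" "len D c > 0"
    "top_pos D a = 1" "top_pos D b = 2" "top_pos D c = 3"
    by auto
  have "case s of
        Flip \<Rightarrow> bot_pos D c = 1 \<and> bot_pos D b = 2 \<and> bot_pos D a = 3
      | TailFirst \<Rightarrow> bot_pos D c = 1 \<and> bot_pos D a = 2 \<and> bot_pos D b = 3
      | HeadLast \<Rightarrow> bot_pos D b = 1 \<and> bot_pos D c = 2 \<and> bot_pos D a = 3"
    using assms unfolding has_shape_def by blast
  then show "bot_pos D a = (if s = TailFirst then 2 else 3)"
    "bot_pos D b = (if s = Flip then 2 else if s = TailFirst then 3 else 1)"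
    "bot_pos D c = (if s = HeadLast then 2 else 1)"
    by (cases s; simp)+
qed

lemma has_shape_card:
  fixes a :: "'a::finite"
  assumes "has_shape s D a b c"
  shows "CARD('a) = 3"
proof -
  have "UNIV = {a, b, c}"
    using has_shape_univ[OF assms] by auto
  then have "CARD('a) = card {a, b, c}"
    by metis
  also have "\<dots> = 3"
    using has_shapeD[OF assms] by simp
  finally show ?thesis .
qed

lemma has_shape_sum:
  fixes f :: "'a::finite \<Rightarrow> real"
  assumes "has_shape s D a b c"
  shows "(\<Sum>e\<in>UNIV. f e) = f a + f b + f c"
proof -
  have "UNIV = {a, b, c}"
    using has_shape_univ[OF assms] by auto
  then have "(\<Sum>e\<in>UNIV. f e) = (\<Sum>e\<in>{a, b, c}. f e)"
    by metis
  then show ?thesis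
    using has_shapeD[OF assms] by simp
qed

lemma has_shape_sum_if:
  fixes f :: "'a::finite \<Rightarrow> real"
  assumes "has_shape s D a b c"
  shows "(\<Sum>e | P e. f e) = (if P a then f a else 0) + (if P b then f b else 0) + (if P c then f c else 0)"
proof -
  have "(\<Sum>e | P e. f e) = (\<Sum>e\<in>UNIV. if P e then f e else 0)"
    by (simp add: sum.If_cases)
  then show ?thesis
    using has_shape_sum[OF assms, of "\<lambda>e. if P e then f e else 0"] by simp
qed

lemma has_shape_last:
  assumes "has_shape s D a b c"
  shows "last_top D = c" "last_bot D = bot_last s a b"
proof -
  note card = has_shape_card[OF assms]
  note shape = has_shapeD[OF assms]
  have "e = c" if "top_pos D e = 3" for e
    using that has_shape_univ[OF assms, of e] shape by auto
  then show "last_top D = c"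
    unfolding last_top_def card using shape(12) by blast
  have 0: "bot_pos D (bot_last s a b) = 3"
    using shape by (simp add: bot_last_def)
  have "e = bot_last s a b" if "bot_pos D e = 3" for e
    using that has_shape_univ[OF assms, of e] shape
    by (auto simp: bot_last_def split: if_splits)
  then show "last_bot D = bot_last s a b"
    unfolding last_bot_def card using 0 by blast
qed

text \<open>Admissibility at \<open>k = 1\<close> forbids \<open>a\<close> as first bottom letter,
  and at \<open>k = 2\<close> it forbids \<open>c\<close> as last one. Of the six bottom rows
  exactly three survive.\<close>

lemma has_shape_exists:
  fixes D :: "'a::finite iet_data"
  assumes "CARD('a) = 3" "iet_data D" "admissible D"
  obtains s a b c where "has_shape s D a b c"
proof -
  have bt: "bij_betw (top_pos D) UNIV {1..3}" and bb: "bij_betw (bot_pos D) UNIV {1..3}"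
    and pos: "\<And>e. len D e > 0"
    using assms(1,2) by (auto simp: iet_data_def)
  have "\<exists>e. top_pos D e = k" if "k \<in> {1..3}" for k
    using that bt unfolding bij_betw_def by (metis imageE)
  from this[of 1] this[of 2] this[of 3]
  obtain a b c where abc: "top_pos D a = 1" "top_pos D b = 2" "top_pos D c = 3"
    by auto
  have inj: "inj (top_pos D)" "inj (bot_pos D)"
    using bt bb by (auto simp: bij_betw_def)
  have cases: "top_pos D e \<in> {1, 2, 3}" "bot_pos D e \<in> {1, 2, 3}" for e
  proof -
    have "{1..3::nat} = {1, 2, 3}" by auto
    then show "top_pos D e \<in> {1, 2, 3}" "bot_pos D e \<in> {1, 2, 3}"
      using bt bb unfolding bij_betw_def by (metis UNIV_I imageI)+
  qed
  have univ: "e = a \<or> e = b \<or> e = c" for e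
    using cases(1)[of e] abc inj(1) by (metis empty_iff injD insert_iff)
  have ne: "a \<noteq> b" "a \<noteq> c" "b \<noteq> c"
    using abc by auto
  have bne: "bot_pos D a \<noteq> bot_pos D b" "bot_pos D a \<noteq> bot_pos D c" "bot_pos D b \<noteq> bot_pos D c"
    using ne inj(2) by (meson injD)+
  have "top_pos D -` {1..1} \<noteq> bot_pos D -` {1..1}" "top_pos D -` {1..2} \<noteq> bot_pos D -` {1..2}"
    using assms(3)[unfolded admissible_def assms(1), rule_format, of 1]
      assms(3)[unfolded admissible_def assms(1), rule_format, of 2] by simp_all
  moreover have "top_pos D -` {1..1} = {a}" "top_pos D -` {1..2} = {a, b}"
    using univ abc by (fastforce simp: set_eq_iff)+
  moreover have "bot_pos D -` {1..1} = {a}" if "bot_pos D a = 1"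
  proof -
    have "bot_pos D b \<noteq> 1" "bot_pos D c \<noteq> 1" using bne that by auto
    then show ?thesis using that univ by auto
  qed
  moreover have "bot_pos D -` {1..2} = {a, b}" if "bot_pos D c = 3"
  proof -
    have "bot_pos D a \<noteq> 3" "bot_pos D b \<noteq> 3" using bne that by auto
    then have "bot_pos D a \<in> {1..2}" "bot_pos D b \<in> {1..2}" "bot_pos D c \<notin> {1..2}"
      using cases(2)[of a] cases(2)[of b] that by auto
    then show ?thesis using univ by blast
  qed
  ultimately have adm: "bot_pos D a \<noteq> 1" "bot_pos D c \<noteq> 3"
    by auto
  have U: "\<forall>e. e = a \<or> e = b \<or> e = c"
    using univ by blast
  consider "bot_pos D c = 1" "bot_pos D b = 2" "bot_pos D a = 3"
    | "bot_pos D c = 1" "bot_pos D a = 2" "bot_pos D b = 3"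
    | "bot_pos D b = 1" "bot_pos D c = 2" "bot_pos D a = 3"
    using cases(2)[of a] cases(2)[of b] cases(2)[of c] bne adm by auto
  then show thesis
  proof cases
    case 1
    then have "has_shape Flip D a b c"
      unfolding has_shape_def using U ne pos abc by (simp only: shape.case simp_thms)
    then show ?thesis by (rule that)
  next
    case 2
    then have "has_shape TailFirst D a b c"
      unfolding has_shape_def using U ne pos abc by (simp only: shape.case simp_thms)
    then show ?thesis by (rule that)
  next
    case 3
    then have "has_shape HeadLast D a b c"
      unfolding has_shape_def using U ne pos abc by (simp only: shape.case simp_thms)
    then show ?thesis by (rule that)
  qed
qed

section \<open>Effect of a Rauzy--Veech step on shapes and lengths\<close>

lemma top_type_iff:
  assumes "has_shape s D a b c"
  shows "top_type D \<longleftrightarrow> len D c > len D (bot_last s a b)"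
  using has_shape_last[OF assms] by (simp add: top_type_def)

text \<open>The Rauzy graph on three letters, up to renaming of letters: \<open>True\<close> is the
  top arrow, \<open>False\<close> the bottom arrow.\<close>

fun next_shape :: "bool \<Rightarrow> shape \<Rightarrow> shape" where
  "next_shape True Flip = TailFirst"
| "next_shape True TailFirst = Flip"
| "next_shape True HeadLast = HeadLast"
| "next_shape False Flip = HeadLast"
| "next_shape False TailFirst = TailFirst"
| "next_shape False HeadLast = Flip"

lemma winner_loser_shape:
  assumes "has_shape s D a b c"
  shows "winner D = (if top_type D then c else bot_last s a b)"
    "loser D = (if top_type D then bot_last s a b else c)"
  using has_shape_last[OF assms] by (simp_all add: winner_def loser_def)

lemma rauzy_step_top_pos:
  assumes "top_type D"
  shows "top_pos (rauzy_step D) = top_pos D"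
    "bot_pos (rauzy_step D) = move_after (winner D) (loser D) (bot_pos D)"
  using assms by (simp_all add: rauzy_step_def)
lemma rauzy_step_bot_pos:
  assumes "\<not> top_type D"
  shows "bot_pos (rauzy_step D) = bot_pos D"
    "top_pos (rauzy_step D) = move_after (winner D) (loser D) (top_pos D)"
  using assms by (simp_all add: rauzy_step_def)
lemma len_rauzy_step:
  "len (rauzy_step D) = (len D)(winner D := len D (winner D) - len D (loser D))"
  by (simp add: rauzy_step_def)

lemma rauzy_step_top:
  assumes "has_shape s D a b c" "top_type D"
  shows "has_shape (next_shape True s) (rauzy_step D) a b c"
    "len (rauzy_step D) = (len D)(c := len D c - len D (bot_last s a b))"
proof -
  have wl: "winner D = c" "loser D = bot_last s a b"
    using winner_loser_shape[OF assms(1)] assms(2) by simp_all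
  have lt: "len D c > len D (bot_last s a b)"
    using top_type_iff[OF assms(1)] assms(2) by simp
  note pos = rauzy_step_top_pos[OF assms(2)]
  note shape = has_shapeD[OF assms(1)]
  show l: "len (rauzy_step D) = (len D)(c := len D c - len D (bot_last s a b))"
    by (simp add: len_rauzy_step wl)
  have U: "\<forall>e. e = a \<or> e = b \<or> e = c"
    using has_shape_univ[OF assms(1)] by blast
  have lens: "len (rauzy_step D) a > 0" "len (rauzy_step D) b > 0" "len (rauzy_step D) c > 0"
    using shape lt by (simp_all add: l)
  have bots: "case next_shape True s of
        Flip \<Rightarrow> bot_pos (rauzy_step D) c = 1 \<and> bot_pos (rauzy_step D) b = 2 \<and> bot_pos (rauzy_step D) a = 3
      | TailFirst \<Rightarrow> bot_pos (rauzy_step D) c = 1 \<and> bot_pos (rauzy_step D) a = 2 \<and> bot_pos (rauzy_step D) b = 3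
      | HeadLast \<Rightarrow> bot_pos (rauzy_step D) b = 1 \<and> bot_pos (rauzy_step D) c = 2 \<and> bot_pos (rauzy_step D) a = 3"
    using shape by (cases s) (simp_all add: pos wl move_after_def bot_last_def)
  show "has_shape (next_shape True s) (rauzy_step D) a b c"
    unfolding has_shape_def pos(1) using U lens bots shape by blast
qed

text \<open>A bottom step moves \<open>c\<close> in the top row. In \<open>TailFirst\<close> the
  winner is \<open>b\<close> and \<open>c\<close> already follows it; otherwise the winner is
  \<open>a\<close>, so \<open>b\<close> and \<open>c\<close> exchange their places and hence their
  roles.\<close>

lemma rauzy_step_bot:
  assumes "has_shape s D a b c" "\<not> top_type D" "len D c \<noteq> len D (bot_last s a b)"
  shows "has_shape (next_shape False s) (rauzy_step D) a
           (if s = TailFirst then b else c) (if s = TailFirst then c else b)"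
    "len (rauzy_step D) = (len D)(bot_last s a b := len D (bot_last s a b) - len D c)"
proof -
  have wl: "winner D = bot_last s a b" "loser D = c"
    using winner_loser_shape[OF assms(1)] assms(2) by simp_all
  have lt: "len D c < len D (bot_last s a b)"
    using top_type_iff[OF assms(1)] assms(2,3) by simp
  note pos = rauzy_step_bot_pos[OF assms(2)]
  note shape = has_shapeD[OF assms(1)]
  show l: "len (rauzy_step D) = (len D)(bot_last s a b := len D (bot_last s a b) - len D c)"
    by (simp add: len_rauzy_step wl)
  define b' c' where "b' = (if s = TailFirst then b else c)" and "c' = (if s = TailFirst then c else b)"
  have U: "\<forall>e. e = a \<or> e = b' \<or> e = c'"
    using has_shape_univ[OF assms(1)] unfolding b'_def c'_def by (cases "s = TailFirst") auto
  have lens: "len (rauzy_step D) a > 0" "len (rauzy_step D) b' > 0" "len (rauzy_step D) c' > 0"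
    using shape lt by (auto simp: l b'_def c'_def bot_last_def)
  have ne: "a \<noteq> b'" "a \<noteq> c'" "b' \<noteq> c'"
    using shape by (simp_all add: b'_def c'_def)
  have tops: "top_pos (rauzy_step D) a = 1" "top_pos (rauzy_step D) b' = 2" "top_pos (rauzy_step D) c' = 3"
    using shape by (cases s; simp add: pos wl move_after_def bot_last_def b'_def c'_def)+
  have bots: "case next_shape False s of
        Flip \<Rightarrow> bot_pos (rauzy_step D) c' = 1 \<and> bot_pos (rauzy_step D) b' = 2 \<and> bot_pos (rauzy_step D) a = 3
      | TailFirst \<Rightarrow> bot_pos (rauzy_step D) c' = 1 \<and> bot_pos (rauzy_step D) a = 2 \<and> bot_pos (rauzy_step D) b' = 3
      | HeadLast \<Rightarrow> bot_pos (rauzy_step D) b' = 1 \<and> bot_pos (rauzy_step D) c' = 2 \<and> bot_pos (rauzy_step D) a = 3"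
    using shape by (cases s) (simp_all add: pos b'_def c'_def)
  have "has_shape (next_shape False s) (rauzy_step D) a b' c'"
    unfolding has_shape_def using U lens bots ne tops by blast
  then show "has_shape (next_shape False s) (rauzy_step D) a
           (if s = TailFirst then b else c) (if s = TailFirst then c else b)"
    by (simp add: b'_def c'_def)
qed

section \<open>Rauzy induction as a slow continued fraction algorithm\<close>

text \<open>The displacements of the first top letter (to the right) and of the first bottom letter (to the
  left).\<close>

definition right_move :: "shape \<Rightarrow> 'a::finite iet_data \<Rightarrow> 'a \<Rightarrow> 'a \<Rightarrow> real" where
  "right_move s D b c = (if s = TailFirst then len D c else len D b + len D c)"

definition left_move :: "shape \<Rightarrow> 'a::finite iet_data \<Rightarrow> 'a \<Rightarrow> 'a \<Rightarrow> real" where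
  "left_move s D a b = (if s = HeadLast then len D a else len D a + len D b)"

text \<open>These are the two arrows into \<open>Flip\<close>. They change a length and the shape,
  but neither displacement.\<close>

definition idle :: "bool \<Rightarrow> shape \<Rightarrow> bool" where
  "idle t s \<longleftrightarrow> (t \<and> s = TailFirst) \<or> (\<not> t \<and> s = HeadLast)"

text \<open>The tuple encodes the displacements \<open>hu * \<beta> - ku * L\<close> to the right
  and \<open>kv * L - hv * \<beta>\<close> to the left. Subtracting one from the other adds the
  coordinate pairs, that is, takes a mediant.\<close>

fun farey_step :: "bool \<Rightarrow> shape \<times> nat \<times> nat \<times> int \<times> int \<Rightarrow> shape \<times> nat \<times> nat \<times> int \<times> int" where
  "farey_step t (s, hu, hv, ku, kv) =
     (if idle t s then (next_shape t s, hu, hv, ku, kv)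
      else if t then (next_shape t s, hu + hv, hv, ku + kv, kv)
      else (next_shape t s, hu, hu + hv, ku, ku + kv))"

text \<open>For \<open>L \<noteq> 0\<close> this is irrationality of
  \<open>\<beta> / L\<close>.\<close>

definition irrational_pair :: "real \<Rightarrow> real \<Rightarrow> bool" where
  "irrational_pair \<beta> L \<longleftrightarrow> (\<forall>i j :: int. of_int i * \<beta> = of_int j * L \<longrightarrow> i = 0)"

text \<open>The middle letter moves like \<open>a\<close> in \<open>TailFirst\<close> and like
  \<open>c\<close> in \<open>HeadLast\<close>. In \<open>Flip\<close> it makes both displacements in
  succession, which costs both heights.\<close>

definition mid_height :: "shape \<Rightarrow> nat \<Rightarrow> nat \<Rightarrow> nat" where
  "mid_height s hu hv = (case s of Flip \<Rightarrow> hu + hv | TailFirst \<Rightarrow> hu | HeadLast \<Rightarrow> hv)"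

text \<open>The numbers \<open>R e\<close> are return times under the exchange, the heights are return times under
  the rotation; they agree up to a factor 2.\<close>

fun farey_state ::
    "real \<Rightarrow> real \<Rightarrow> 'a::finite iet_data \<Rightarrow> ('a \<Rightarrow> real) \<Rightarrow> shape \<times> nat \<times> nat \<times> int \<times> int \<Rightarrow> bool" where
  "farey_state \<beta> L D R (s, hu, hv, ku, kv) \<longleftrightarrow>
     (\<exists>a b c. has_shape s D a b c \<and> hu \<ge> 1 \<and> hv \<ge> 1 \<and> int hu * kv - int hv * ku = 1 \<and>
        right_move s D b c = real hu * \<beta> - of_int ku * L \<and>
        left_move s D a b = of_int kv * L - real hv * \<beta> \<and>
        (\<forall>i j :: int. len D b \<noteq> of_int i * \<beta> + of_int j * L) \<and>
        R a \<in> {real hu / 2..real hu} \<and> R c \<in> {real hv / 2..real hv} \<and>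
        R b \<in> {real (mid_height s hu hv) / 2..real (mid_height s hu hv)})"

text \<open>From \<open>TailFirst\<close> the loser is \<open>b\<close>: it becomes the middle
  letter of \<open>Flip\<close> and neither displacement changes. From the other shapes the loser is
  \<open>a\<close>, and shortening \<open>c\<close> by \<open>a\<close> replaces the right
  displacement \<open>x\<close> by \<open>x - y\<close>.\<close>

lemma farey_state_top:
  assumes st: "farey_state \<beta> L D R (s, hu, hv, ku, kv)" and t: "top_type D"
    and R': "\<And>e. R' e = R e + (if e = loser D then R (winner D) else 0)"
  shows "farey_state \<beta> L (rauzy_step D) R' (farey_step True (s, hu, hv, ku, kv))"
proof -
  from st obtain a b c where sh: "has_shape s D a b c" and h: "hu \<ge> 1" "hv \<ge> 1"
    and det: "int hu * kv - int hv * ku = 1"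
    and rm: "right_move s D b c = real hu * \<beta> - of_int ku * L"
    and lm: "left_move s D a b = of_int kv * L - real hv * \<beta>"
    and gen: "\<forall>i j :: int. len D b \<noteq> of_int i * \<beta> + of_int j * L"
    and R: "R a \<in> {real hu / 2..real hu}" "R c \<in> {real hv / 2..real hv}"
      "R b \<in> {real (mid_height s hu hv) / 2..real (mid_height s hu hv)}"
    by auto
  note shape = has_shapeD[OF sh]
  have wl: "winner D = c" "loser D = bot_last s a b"
    using winner_loser_shape[OF sh] t by simp_all
  note new = rauzy_step_top[OF sh t]
  have gen': "\<forall>i j :: int. len (rauzy_step D) b \<noteq> of_int i * \<beta> + of_int j * L"
    using gen shape by (simp add: new(2))
  show ?thesis
  proof (cases "s = TailFirst")
    case True
    have "has_shape Flip (rauzy_step D) a b c" using new(1) True by simp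
    moreover have "right_move Flip (rauzy_step D) b c = real hu * \<beta> - of_int ku * L"
      using rm shape by (simp add: new(2) True right_move_def bot_last_def)
    moreover have "left_move Flip (rauzy_step D) a b = of_int kv * L - real hv * \<beta>"
      using lm shape by (simp add: new(2) True left_move_def bot_last_def)
    moreover have "R' a \<in> {real hu / 2..real hu}" "R' c \<in> {real hv / 2..real hv}"
      "R' b \<in> {real (hu + hv) / 2..real (hu + hv)}"
      using R shape by (simp_all add: R' wl True bot_last_def mid_height_def)
    ultimately have "farey_state \<beta> L (rauzy_step D) R' (Flip, hu, hv, ku, kv)"
      using gen' h det by (auto simp: mid_height_def)
    then show ?thesis by (simp add: True idle_def)
  next
    case False
    have r: "right_move (next_shape True s) (rauzy_step D) b c = real (hu + hv) * \<beta> - of_int (ku + kv) * L"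
      using rm lm shape False
      by (cases s) (simp_all add: new(2) left_move_def right_move_def bot_last_def algebra_simps)
    have l: "left_move (next_shape True s) (rauzy_step D) a b = of_int kv * L - real hv * \<beta>"
      using lm shape False by (cases s) (simp_all add: new(2) left_move_def bot_last_def)
    have "R' a \<in> {real (hu + hv) / 2..real (hu + hv)}" "R' c \<in> {real hv / 2..real hv}"
      "R' b \<in> {real (mid_height (next_shape True s) (hu + hv) hv) / 2..
                real (mid_height (next_shape True s) (hu + hv) hv)}"
      using R shape False
      by (cases s; simp add: R' wl bot_last_def mid_height_def add_divide_distrib)+
    then have "farey_state \<beta> L (rauzy_step D) R' (next_shape True s, hu + hv, hv, ku + kv, kv)"
      unfolding farey_state.simps using new(1) gen' h det r l
      by (intro exI[of _ a] exI[of _ b] exI[of _ c] conjI) (auto simp: algebra_simps)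
    then show ?thesis using False by (simp add: idle_def)
  qed
qed

text \<open>Bottom type formally includes equal lengths, so equality has to be excluded here. The
  genericity of \<open>len D b\<close> in the invariant serves this purpose.\<close>

lemma farey_state_bot:
  assumes irr: "irrational_pair \<beta> L"
    and st: "farey_state \<beta> L D R (s, hu, hv, ku, kv)" and t: "\<not> top_type D"
    and R': "\<And>e. R' e = R e + (if e = loser D then R (winner D) else 0)"
  shows "farey_state \<beta> L (rauzy_step D) R' (farey_step False (s, hu, hv, ku, kv))"
proof -
  from st obtain a b c where sh: "has_shape s D a b c" and h: "hu \<ge> 1" "hv \<ge> 1"
    and det: "int hu * kv - int hv * ku = 1"
    and rm: "right_move s D b c = real hu * \<beta> - of_int ku * L"
    and lm: "left_move s D a b = of_int kv * L - real hv * \<beta>"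
    and gen: "\<forall>i j :: int. len D b \<noteq> of_int i * \<beta> + of_int j * L"
    and R: "R a \<in> {real hu / 2..real hu}" "R c \<in> {real hv / 2..real hv}"
      "R b \<in> {real (mid_height s hu hv) / 2..real (mid_height s hu hv)}"
    by auto
  note shape = has_shapeD[OF sh]
  have wl: "winner D = bot_last s a b" "loser D = c"
    using winner_loser_shape[OF sh] t by simp_all
  \<comment> \<open>In \<open>Flip\<close> equality would make the two displacements equal, a
    relation between \<open>\<beta>\<close> and \<open>L\<close>. In the other shapes it would put
    \<open>len D b\<close> into the group generated by \<open>\<beta>\<close> and
    \<open>L\<close>.\<close>
  have ne: "len D c \<noteq> len D (bot_last s a b)"
  proof
    assume eq: "len D c = len D (bot_last s a b)"
    show False
    proof (cases s)
      case Flip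
      then have "of_int (int hu + int hv) * \<beta> = of_int (ku + kv) * L"
        using eq rm lm by (simp add: right_move_def left_move_def bot_last_def algebra_simps)
      then show False
        using irr h unfolding irrational_pair_def by fastforce
    next
      case TailFirst
      then have "len D b = of_int (int hu) * \<beta> + of_int (- ku) * L"
        using eq rm by (simp add: right_move_def bot_last_def)
      then show False using gen by blast
    next
      case HeadLast
      then have "len D b = of_int (int hu + int hv) * \<beta> + of_int (- ku - kv) * L"
        using eq rm lm by (simp add: right_move_def left_move_def bot_last_def algebra_simps)
      then show False using gen by blast
    qed
  qed
  note new = rauzy_step_bot[OF sh t ne]
  show ?thesis
  proof (cases "s = TailFirst")
    case True
    have sh': "has_shape TailFirst (rauzy_step D) a b c" using new(1) True by simp
    have r: "right_move TailFirst (rauzy_step D) b c = real hu * \<beta> - of_int ku * L"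
      using rm shape by (simp add: new(2) True right_move_def bot_last_def)
    have l: "left_move TailFirst (rauzy_step D) a b = of_int (ku + kv) * L - real (hu + hv) * \<beta>"
      using lm rm shape
      by (simp add: new(2) True left_move_def right_move_def bot_last_def algebra_simps)
    have gen': "\<forall>i j :: int. len (rauzy_step D) b \<noteq> of_int i * \<beta> + of_int j * L"
    proof (intro allI notI)
      fix i j :: int
      assume "len (rauzy_step D) b = of_int i * \<beta> + of_int j * L"
      then have "len D b = of_int (i + int hu) * \<beta> + of_int (j - ku) * L"
        using rm shape by (simp add: new(2) True right_move_def bot_last_def algebra_simps)
      then show False using gen by blast
    qed
    have "R' a \<in> {real hu / 2..real hu}" "R' c \<in> {real (hu + hv) / 2..real (hu + hv)}"
      "R' b \<in> {real hu / 2..real hu}"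
      using R shape by (simp_all add: R' wl True bot_last_def mid_height_def add_divide_distrib)
    then have "farey_state \<beta> L (rauzy_step D) R' (TailFirst, hu, hu + hv, ku, ku + kv)"
      unfolding farey_state.simps using sh' gen' h det r l
      by (intro exI[of _ a] exI[of _ b] exI[of _ c] conjI) (auto simp: algebra_simps mid_height_def)
    then show ?thesis by (simp add: True idle_def)
  next
    case False
    have sh': "has_shape (next_shape False s) (rauzy_step D) a c b" using new(1) False by simp
    have r: "right_move (next_shape False s) (rauzy_step D) c b = real hu * \<beta> - of_int ku * L"
      using rm shape False
      by (cases s) (simp_all add: new(2) right_move_def bot_last_def)
    \<comment> \<open>Now \<open>c\<close> is the middle letter. Its length is the right
      displacement minus \<open>len D b\<close>, so genericity passes from \<open>b\<close> to
      \<open>c\<close>.\<close>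
    have gen': "\<forall>i j :: int. len (rauzy_step D) c \<noteq> of_int i * \<beta> + of_int j * L"
    proof (intro allI notI)
      fix i j :: int
      assume "len (rauzy_step D) c = of_int i * \<beta> + of_int j * L"
      then have "len D b = of_int (int hu - i) * \<beta> + of_int (- ku - j) * L"
        using rm shape False by (simp add: new(2) right_move_def bot_last_def algebra_simps)
      then show False using gen by blast
    qed
    show ?thesis
    proof (cases s)
      case Flip
      have l: "left_move HeadLast (rauzy_step D) a c = of_int (ku + kv) * L - real (hu + hv) * \<beta>"
        using lm rm shape Flip
        by (simp add: new(2) left_move_def right_move_def bot_last_def algebra_simps)
      have "R' a \<in> {real hu / 2..real hu}" "R' c \<in> {real (hu + hv) / 2..real (hu + hv)}"
        "R' b \<in> {real (hu + hv) / 2..real (hu + hv)}"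
        using R shape by (simp_all add: R' wl Flip bot_last_def mid_height_def add_divide_distrib)
      then have "farey_state \<beta> L (rauzy_step D) R' (HeadLast, hu, hu + hv, ku, ku + kv)"
        unfolding farey_state.simps using sh' gen' h det r l Flip
        by (intro exI[of _ a] exI[of _ c] exI[of _ b] conjI) (auto simp: algebra_simps mid_height_def)
      then show ?thesis by (simp add: Flip idle_def)
    next
      case HeadLast
      have l: "left_move Flip (rauzy_step D) a c = of_int kv * L - real hv * \<beta>"
        using lm shape HeadLast
        by (simp add: new(2) left_move_def bot_last_def)
      have "R' a \<in> {real hu / 2..real hu}" "R' b \<in> {real hv / 2..real hv}"
        "R' c \<in> {real (hu + hv) / 2..real (hu + hv)}"
        using R shape by (simp_all add: R' wl HeadLast bot_last_def mid_height_def add_divide_distrib)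
      then have "farey_state \<beta> L (rauzy_step D) R' (Flip, hu, hv, ku, kv)"
        unfolding farey_state.simps using sh' gen' h det r l HeadLast
        by (intro exI[of _ a] exI[of _ c] exI[of _ b] conjI) (auto simp: algebra_simps mid_height_def)
      then show ?thesis by (simp add: HeadLast idle_def)
    qed (use False in simp)
  qed
qed

lemma farey_state_step:
  assumes "irrational_pair \<beta> L" "farey_state \<beta> L D R st"
    and "\<And>e. R' e = R e + (if e = loser D then R (winner D) else 0)"
  shows "farey_state \<beta> L (rauzy_step D) R' (farey_step (top_type D) st)"
  using farey_state_top[of \<beta> L D R _ _ _ _ _ R'] farey_state_bot[of \<beta> L D R _ _ _ _ _ R'] assms
  by (cases st; cases "top_type D") (simp_all del: farey_step.simps farey_state.simps)

section \<open>Row sums of the matrices of the algorithm\<close>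

definition row_sum :: "real^'a^'a \<Rightarrow> 'a::finite \<Rightarrow> real" where
  "row_sum A i = (\<Sum>j\<in>UNIV. A $ i $ j)"

lemma step_matrix_mult_nth:
  "(step_matrix D ** A) $ i $ j = A $ i $ j + (if i = loser D then A $ winner D $ j else 0)"
proof -
  have "(step_matrix D ** A) $ i $ j =
    (\<Sum>k\<in>UNIV. (if i = k then A $ k $ j else 0) + (if k = winner D \<and> i = loser D then A $ k $ j else 0))"
    unfolding matrix_matrix_mult_def step_matrix_def unit_matrix_def mat_def
    by (auto intro!: sum.cong simp: distrib_right)
  also have "\<dots> = A $ i $ j + (if i = loser D then A $ winner D $ j else 0)"
    by (cases "i = loser D") (simp_all add: sum.distrib)
  finally show ?thesis .
qed

text \<open>This is the recursion of return times: after a step the loser first takes its own old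
  return and then that of the winner. It matches the update of \<open>R\<close> in
  \<open>farey_state_step\<close>.\<close>

lemma row_sum_step_matrix:
  "row_sum (step_matrix D ** A) i = row_sum A i + (if i = loser D then row_sum A (winner D) else 0)"
  unfolding row_sum_def step_matrix_mult_nth by (simp add: sum.distrib)

lemma Q_matrix_nonneg: "Q_matrix D m n $ i $ j \<ge> 0"
  by (induction n arbitrary: i) (auto simp: mat_def step_matrix_mult_nth)

lemma matrix_norm_nonneg_rows:
  assumes "\<And>i j. A $ i $ j \<ge> 0"
  shows "matrix_norm A = (\<Sum>i\<in>UNIV. row_sum A i)"
  using assms by (simp add: matrix_norm_def row_sum_def)

text \<open>The initial tuple encodes the displacements \<open>\<beta>\<close> and
  \<open>L - \<beta>\<close>.\<close>

primrec farey_path :: "'a::finite iet_data \<Rightarrow> shape \<Rightarrow> nat \<Rightarrow> shape \<times> nat \<times> nat \<times> int \<times> int" where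
  "farey_path D s 0 = (s, 1, 1, 0, 1)"
| "farey_path D s (Suc n) = farey_step (top_type (rauzy_iter D n)) (farey_path D s n)"

lemma farey_path_state:
  assumes "has_shape s D a b c" "irrational_pair \<beta> L"
    and "\<beta> = right_move s D b c" "L = right_move s D b c + left_move s D a b"
    and "\<And>i j :: int. len D b \<noteq> of_int i * \<beta> + of_int j * L"
  shows "farey_state \<beta> L (rauzy_iter D n) (row_sum (Q_matrix D 0 n)) (farey_path D s n)"
proof (induction n)
  case 0
  have "row_sum (mat 1 :: real^'a^'a) e = 1" for e
    by (simp add: row_sum_def mat_def)
  \<comment> \<open>In \<open>Flip\<close> the middle letter starts with height 2 and row sum 1;
    this forces the factor 2 in the invariant.\<close>
  moreover have "mid_height s 1 1 \<in> {1, 2}"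
    by (cases s) (simp_all add: mid_height_def)
  ultimately have "farey_state \<beta> L D (row_sum (mat 1)) (s, 1, 1, 0, 1)"
    unfolding farey_state.simps using assms
    by (intro exI[of _ a] exI[of _ b] exI[of _ c] conjI) auto
  then show ?case
    by (simp add: rauzy_iter_def del: farey_state.simps)
next
  case (Suc n)
  have "farey_state \<beta> L (rauzy_step (rauzy_iter D n)) (row_sum (Q_matrix D 0 (Suc n)))
      (farey_step (top_type (rauzy_iter D n)) (farey_path D s n))"
    by (rule farey_state_step[OF assms(2) Suc.IH]) (simp add: row_sum_step_matrix)
  then show ?case
    by (simp only: farey_path.simps rauzy_iter_def funpow.simps comp_apply)
qed

section \<open>Exchanges as induced rotations\<close>

text \<open>A first return map to \<open>[0, l)\<close> of the rotation by \<open>\<beta>\<close> on the circle of length \<open>L\<close>, in which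
  no orbit leaves the interval for two consecutive steps.\<close>

locale induced_rotation =
  fixes T :: "real \<Rightarrow> real" and \<beta> L l :: real
  assumes L_pos: "0 < L" and l_le: "l \<le> L"
    and T_cases: "\<And>p. 0 \<le> p \<Longrightarrow> p < l \<Longrightarrow>
      \<exists>(w::nat) v::int. T p = p + real w * \<beta> - of_int v * L \<and> 0 \<le> T p \<and> T p < l \<and>
        (w = 1 \<or> w = 2 \<and> l \<le> p + \<beta> \<and> p + \<beta> < L)"
begin

text \<open>One application of \<open>T\<close> is one or two rotation steps, hence between
  \<open>j\<close> and \<open>2 * j\<close> of them for \<open>j\<close> applications.\<close>

lemma funpow_rotation:
  assumes "0 \<le> p" "p < l"
  shows "\<exists>(n::nat) m::int. j \<le> n \<and> n \<le> 2 * j \<and> (T ^^ j) p = p + real n * \<beta> - of_int m * L \<and>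
    0 \<le> (T ^^ j) p \<and> (T ^^ j) p < l"
proof (induction j)
  case 0
  show ?case using assms by (intro exI[of _ 0]) auto
next
  case (Suc j)
  then obtain n :: nat and m :: int where n: "j \<le> n" "n \<le> 2 * j"
    "(T ^^ j) p = p + real n * \<beta> - of_int m * L" and q: "0 \<le> (T ^^ j) p" "(T ^^ j) p < l"
    by blast
  from T_cases[OF q] obtain w :: nat and v :: int where
    w: "T ((T ^^ j) p) = (T ^^ j) p + real w * \<beta> - of_int v * L" "0 \<le> T ((T ^^ j) p)"
      "T ((T ^^ j) p) < l" "w = 1 \<or> w = 2"
    by blast
  show ?case
    using n w by (intro exI[of _ "n + w"] exI[of _ "m + v"]) (auto simp: algebra_simps)
qed

text \<open>The orbit under \<open>T\<close> omits only rotation points outside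
  \<open>[0, l)\<close>, so a rotation orbit that reaches a point of the interval is matched by
  \<open>T\<close>, in no more steps.\<close>

lemma rotation_visit:
  assumes "n \<ge> 1" "0 \<le> p" "p < l" "0 \<le> q" "q < l" "q = p + real n * \<beta> - of_int m * L"
  shows "\<exists>j\<ge>1. j \<le> n \<and> (T ^^ j) p = q"
  using assms
proof (induction n arbitrary: p m rule: less_induct)
  case (less n)
  from T_cases[OF less.prems(2,3)] obtain w :: nat and v :: int where
    w: "T p = p + real w * \<beta> - of_int v * L" "0 \<le> T p" "T p < l"
      "w = 1 \<or> w = 2 \<and> l \<le> p + \<beta> \<and> p + \<beta> < L"
    by blast
  \<comment> \<open>Two points of the interval that agree modulo \<open>L\<close> are therefore
    equal.\<close>
  have small: "k = 0" if "\<bar>of_int k * L\<bar> < L" for k :: int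
  proof (rule ccontr)
    assume "k \<noteq> 0"
    then have "1 * L \<le> of_int \<bar>k\<bar> * L"
      using L_pos by (intro mult_right_mono) linarith+
    then show False
      using that L_pos by (simp add: abs_mult)
  qed
  consider "n < w" | "n = w" | "w < n" by linarith
  then show ?case
  proof cases
    \<comment> \<open>Here \<open>q\<close> would be the point skipped by a double step, which lies
      in \<open>[l, L)\<close>, against \<open>q < l\<close>.\<close>
    case 1
    then have "n = 1" "w = 2" using less.prems(1) w(4) by auto
    then have q: "q = p + \<beta> - of_int m * L" and p: "l \<le> p + \<beta>" "p + \<beta> < L"
      using less.prems w(4) by auto
    have "\<bar>of_int m * L\<bar> < L"
      using q p less.prems(4,5) l_le by linarith
    then have "m = 0" by (rule small)
    then show ?thesis using q p less.prems by simp
  next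
    case 2
    then have "q - T p = of_int (v - m) * L"
      using less.prems w by (simp add: algebra_simps)
    then have "\<bar>of_int (v - m) * L\<bar> < L"
      using less.prems w l_le by linarith
    then have "v - m = 0" by (rule small)
    then have "T p = q" using \<open>q - T p = _\<close> by simp
    then show ?thesis using less.prems(1) by (intro exI[of _ 1]) simp
  next
    case 3
    have "q = T p + real (n - w) * \<beta> - of_int (m - v) * L"
      using 3 less.prems(6) w(1) by (simp add: algebra_simps)
    moreover have "n - w < n" "n - w \<ge> 1" using 3 w(4) by auto
    ultimately obtain j where j: "j \<ge> 1" "j \<le> n - w" "(T ^^ j) (T p) = q"
      using less.IH[of "n - w" "T p" "m - v"] less.prems(4,5) w(2,3) by blast
    then have "(T ^^ Suc j) p = q" by (simp add: funpow_swap1)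
    moreover have "Suc j \<le> n" using j 3 w(4) by auto
    ultimately show ?thesis by (intro exI[of _ "Suc j"]) auto
  qed
qed

lemma return_le:
  assumes "n \<ge> 1" "0 \<le> p" "p < l" "0 \<le> p + (real n * \<beta> - of_int m * L)"
    "p + (real n * \<beta> - of_int m * L) < l" "\<bar>real n * \<beta> - of_int m * L\<bar> < r"
  shows "(LEAST j. j \<ge> 1 \<and> \<bar>(T ^^ j) p - p\<bar> < r) \<in> {1..n}"
proof -
  obtain j where j: "j \<ge> 1" "j \<le> n" "(T ^^ j) p = p + (real n * \<beta> - of_int m * L)"
    using rotation_visit[of n p "p + (real n * \<beta> - of_int m * L)" m] assms by (auto simp: algebra_simps)
  then have P: "j \<ge> 1 \<and> \<bar>(T ^^ j) p - p\<bar> < r"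
    using assms(6) by simp
  then show ?thesis
    using LeastI[of "\<lambda>j. j \<ge> 1 \<and> \<bar>(T ^^ j) p - p\<bar> < r" j]
      Least_le[of "\<lambda>j. j \<ge> 1 \<and> \<bar>(T ^^ j) p - p\<bar> < r" j] j(2) by auto
qed

text \<open>The given return \<open>j\<close> ensures that \<open>LEAST\<close> picks an actual
  return time. The factor 2 is the price of double steps.\<close>

lemma return_ge:
  assumes "0 \<le> p" "p < l" "j \<ge> 1" "\<bar>(T ^^ j) p - p\<bar> < r"
    and gap: "\<And>(n::nat) m::int. 1 \<le> n \<Longrightarrow> n < N \<Longrightarrow> r \<le> \<bar>real n * \<beta> - of_int m * L\<bar>"
  shows "N \<le> 2 * (LEAST j. j \<ge> 1 \<and> \<bar>(T ^^ j) p - p\<bar> < r)"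
proof -
  define i where "i = (LEAST j. j \<ge> 1 \<and> \<bar>(T ^^ j) p - p\<bar> < r)"
  have i: "i \<ge> 1" "\<bar>(T ^^ i) p - p\<bar> < r"
    using LeastI[of "\<lambda>j. j \<ge> 1 \<and> \<bar>(T ^^ j) p - p\<bar> < r" j] assms(3,4) unfolding i_def by auto
  obtain n :: nat and m :: int where n: "i \<le> n" "n \<le> 2 * i" "(T ^^ i) p = p + real n * \<beta> - of_int m * L"
    using funpow_rotation[OF assms(1,2), of i] by blast
  have "\<bar>real n * \<beta> - of_int m * L\<bar> < r"
    using i(2) n(3) by (simp add: algebra_simps)
  then have "\<not> n < N" using gap[of n m] i n by force
  then show ?thesis using n(2) unfolding i_def by linarith
qed

end

text \<open>The lattice vectors \<open>(hu, ku)\<close> and \<open>(hv, kv)\<close> form a basis, and a vector whose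
  coordinates in it have opposite signs is displaced by at least one of the basis displacements.\<close>

lemma farey_gap:
  fixes hu hv n :: nat and ku kv m :: int and \<beta> L :: real
  assumes det: "int hu * kv - int hv * ku = 1"
    and x: "x = real hu * \<beta> - of_int ku * L" "x > 0" and y: "y = of_int kv * L - real hv * \<beta>" "y > 0"
    and n: "1 \<le> n" "n < hu + hv"
  shows "min x y \<le> \<bar>real n * \<beta> - of_int m * L\<bar>"
proof -
  \<comment> \<open>Cramer's rule: \<open>(n, m)\<close> equals \<open>a\<close> times
    \<open>(hu, ku)\<close> plus \<open>b\<close> times \<open>(hv, kv)\<close>. For
    \<open>a, b\<close> both positive \<open>n\<close> would be at least \<open>hu + hv\<close>, for
    both nonpositive at most 0.\<close>
  define a b where "a = int n * kv - m * int hv" and "b = m * int hu - int n * ku"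
  have "a * int hu + b * int hv = int n * (int hu * kv - int hv * ku)"
    by (simp add: a_def b_def algebra_simps)
  then have sum: "a * int hu + b * int hv = int n"
    using det by simp
  have "of_int a * x - of_int b * y = of_int (int hu * kv - int hv * ku) * (real n * \<beta> - of_int m * L)"
    by (simp add: a_def b_def x(1) y(1) algebra_simps)
  then have disp: "real n * \<beta> - of_int m * L = of_int a * x - of_int b * y"
    using det by simp
  consider "a \<ge> 1" "b \<ge> 1" | "a \<le> 0" "b \<le> 0" | "a \<ge> 1" "b \<le> 0" | "a \<le> 0" "b \<ge> 1"
    by linarith
  then show ?thesis
  proof cases
    case 1
    then have "1 * int hu + 1 * int hv \<le> a * int hu + b * int hv"
      by (intro add_mono mult_right_mono) auto
    then show ?thesis using sum n by linarith
  next
    case 2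
    then have "a * int hu + b * int hv \<le> 0"
      by (intro add_nonpos_nonpos mult_nonpos_nonneg) auto
    then show ?thesis using sum n by linarith
  next
    case 3
    then have "1 * x \<le> of_int a * x" "of_int b * y \<le> 0"
      using x y by (auto intro: mult_right_mono mult_nonpos_nonneg)
    then show ?thesis using disp by linarith
  next
    case 4
    then have "1 * y \<le> of_int b * y" "of_int a * x \<le> 0"
      using x y by (auto intro: mult_right_mono mult_nonpos_nonneg)
    then show ?thesis using disp by linarith
  qed
qed

section \<open>The three-interval exchange as an induced rotation, and the Keane property\<close>

lemma has_shape_left:
  assumes "has_shape s D a b c"
  shows "total_len D = len D a + len D b + len D c"
    "top_left D a = 0" "top_left D b = len D a" "top_left D c = len D a + len D b"
    "bot_left D a = (if s = TailFirst then len D c else len D b + len D c)"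
    "bot_left D b = (if s = Flip then len D c else if s = TailFirst then len D c + len D a else 0)"
    "bot_left D c = (if s = HeadLast then len D b else 0)"
  using has_shape_sum[OF assms] has_shape_sum_if[OF assms] has_shapeD[OF assms]
  by (auto simp: total_len_def top_left_def bot_left_def)

lemma iet_eq:
  assumes sh: "has_shape s D a b c" and x: "x \<in> top_interval D e"
  shows "iet D x = x + bot_left D e - top_left D e"
proof -
  have "e' = e" if "x \<in> top_interval D e'" for e'
    using that x has_shape_univ[OF sh, of e] has_shape_univ[OF sh, of e'] has_shapeD[OF sh]
      has_shape_left[OF sh]
    by (auto simp: top_interval_def)
  then have "(THE e. x \<in> top_interval D e) = e"
    using x by blast
  then show ?thesis by (simp add: iet_def)
qed

text \<open>Letter \<open>a\<close> moves by \<open>\<beta>\<close> and \<open>c\<close> by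
  \<open>\<beta> - L\<close>. In \<open>Flip\<close> the circle is longer than the interval by
  \<open>len D b\<close>, and \<open>b\<close> moves by \<open>2 * \<beta> - L\<close>, passing
  through the extra arc; in the other shapes \<open>b\<close> moves like \<open>a\<close> or
  \<open>c\<close>.\<close>

lemma induced_rotation_iet:
  assumes sh: "has_shape s D a b c"
  shows "induced_rotation (iet D) (right_move s D b c) (right_move s D b c + left_move s D a b) (total_len D)"
proof
  note shape = has_shapeD[OF sh] and left = has_shape_left[OF sh]
  show "0 < right_move s D b c + left_move s D a b"
    using shape by (auto simp: right_move_def left_move_def)
  show "total_len D \<le> right_move s D b c + left_move s D a b"
    using shape left by (auto simp: right_move_def left_move_def)
  fix p assume p: "0 \<le> p" "p < total_len D"
  then consider "p \<in> top_interval D a" | "p \<in> top_interval D b" | "p \<in> top_interval D c"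
    using left by (force simp: top_interval_def)
  then show "\<exists>(w::nat) v::int. iet D p = p + real w * right_move s D b c -
          of_int v * (right_move s D b c + left_move s D a b) \<and> 0 \<le> iet D p \<and> iet D p < total_len D \<and>
        (w = 1 \<or> w = 2 \<and> total_len D \<le> p + right_move s D b c \<and>
          p + right_move s D b c < right_move s D b c + left_move s D a b)"
  proof cases
    case 1
    show ?thesis
      using 1 iet_eq[OF sh 1] shape left
      by (intro exI[of _ 1] exI[of _ 0]) (auto simp: top_interval_def right_move_def)
  next
    case 2
    show ?thesis
    proof (cases s)
      case Flip
      show ?thesis
        using 2 iet_eq[OF sh 2] shape left Flip
        by (intro exI[of _ 2] exI[of _ 1]) (auto simp: top_interval_def right_move_def left_move_def)
    next
      case TailFirst
      show ?thesis
        using 2 iet_eq[OF sh 2] shape left TailFirst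
        by (intro exI[of _ 1] exI[of _ 0]) (auto simp: top_interval_def right_move_def left_move_def)
    next
      case HeadLast
      show ?thesis
        using 2 iet_eq[OF sh 2] shape left HeadLast
        by (intro exI[of _ 1] exI[of _ 1]) (auto simp: top_interval_def right_move_def left_move_def)
    qed
  next
    case 3
    show ?thesis
      using 3 iet_eq[OF sh 3] shape left
      by (intro exI[of _ 1] exI[of _ 1]) (auto simp: top_interval_def right_move_def left_move_def)
  qed
qed

text \<open>A relation with \<open>i \<noteq> 0\<close> says that the rotation carries one of the
  two endpoints to the other, the direction depending on the sign of \<open>i\<close>. By
  \<open>rotation_visit\<close> so does the exchange, against the Keane property.\<close>

lemma keane_no_relation:
  assumes sh: "has_shape s D a b c" and "keane D"
    and e: "e \<in> {b, c}" "e' \<in> {b, c}"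
    and rel: "top_left D e' - top_left D e =
      of_int i * right_move s D b c + of_int j * (right_move s D b c + left_move s D a b)"
  shows "i = 0"
proof -
  interpret induced_rotation "iet D" "right_move s D b c" "right_move s D b c + left_move s D a b" "total_len D"
    by (rule induced_rotation_iet[OF sh])
  note shape = has_shapeD[OF sh] and left = has_shape_left[OF sh]
  have *: "\<not> n \<ge> 1" if f: "f \<in> {b, c}" "f' \<in> {b, c}" "top_left D f' = top_left D f +
      real n * right_move s D b c - of_int m * (right_move s D b c + left_move s D a b)" for f f' n m
  proof
    assume "n \<ge> 1"
    have range: "0 \<le> top_left D g" "top_left D g < total_len D" if "g \<in> {b, c}" for g
      using that left shape by auto
    obtain k where "k \<ge> 1" "(iet D ^^ k) (top_left D f) = top_left D f'"
      using rotation_visit[OF \<open>n \<ge> 1\<close> range[OF f(1)] range[OF f(2)] f(3)] by blast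
    moreover have "top_pos D f' > 1" using f(2) shape by auto
    ultimately show False using \<open>keane D\<close> unfolding keane_def by blast
  qed
  have "\<not> nat i \<ge> 1" if "i \<ge> 0"
    using *[OF e, of "nat i" "-j"] rel that by (simp add: algebra_simps)
  moreover have "\<not> nat (-i) \<ge> 1" if "i \<le> 0"
    using *[OF e(2,1), of "nat (-i)" j] rel that by (simp add: algebra_simps)
  ultimately show ?thesis by linarith
qed

text \<open>The endpoint of \<open>b\<close> paired with itself gives irrationality. The endpoints
  of \<open>b\<close> and \<open>c\<close> differ by \<open>len D b\<close>, so a representation
  would reduce to an integer multiple of \<open>L\<close>, impossible as
  \<open>0 < len D b < L\<close>.\<close>

lemma keane_generic:
  assumes sh: "has_shape s D a b c" and "keane D"
    and "\<beta> = right_move s D b c" "L = right_move s D b c + left_move s D a b"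
  shows "irrational_pair \<beta> L" "len D b \<noteq> of_int i * \<beta> + of_int j * L"
proof -
  note shape = has_shapeD[OF sh] and left = has_shape_left[OF sh]
  show "irrational_pair \<beta> L"
    unfolding irrational_pair_def
  proof (intro allI impI)
    fix i j :: int
    assume "of_int i * \<beta> = of_int j * L"
    then show "i = 0"
      using keane_no_relation[OF sh \<open>keane D\<close>, of b b i "-j"] assms(3,4) by simp
  qed
  show "len D b \<noteq> of_int i * \<beta> + of_int j * L"
  proof
    assume eq: "len D b = of_int i * \<beta> + of_int j * L"
    then have "i = 0"
      using keane_no_relation[OF sh \<open>keane D\<close>, of b c i j] assms(3,4) left by simp
    then have b: "len D b = of_int j * L" using eq by simp
    have lt: "0 < len D b" "len D b < L"
      using shape assms(4) by (auto simp: right_move_def left_move_def)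
    have "0 < j"
      using b lt by (metis less_trans of_int_0_less_iff zero_less_mult_pos2)
    then have "1 * L \<le> of_int j * L"
      using lt by (intro mult_right_mono) auto
    then show False using b lt by linarith
  qed
qed

section \<open>Farey sequences and their blocks\<close>

text \<open>The flags \<open>P\<close> and \<open>Q\<close> stand for the shapes \<open>TailFirst\<close> and \<open>HeadLast\<close>, so that
  exchanging top and bottom is the symmetry \<open>t \<leftrightarrow> \<not> t\<close>, \<open>P \<leftrightarrow> Q\<close>, \<open>hu \<leftrightarrow> hv\<close>, \<open>x \<leftrightarrow> y\<close>.\<close>

locale farey_sequence =
  fixes L :: real and t P Q :: "nat \<Rightarrow> bool" and hu hv :: "nat \<Rightarrow> nat" and x y :: "nat \<Rightarrow> real"
  assumes x_pos: "\<And>n. x n > 0" and y_pos: "\<And>n. y n > 0"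
    and hu_pos: "\<And>n. hu n \<ge> 1" and hv_pos: "\<And>n. hv n \<ge> 1"
    and area: "\<And>n. real (hu n) * y n + real (hv n) * x n = L"
    and top_idle: "\<And>n. t n \<Longrightarrow> P n \<Longrightarrow> x (Suc n) = x n \<and> y (Suc n) = y n \<and>
      hu (Suc n) = hu n \<and> hv (Suc n) = hv n \<and> \<not> P (Suc n) \<and> \<not> Q (Suc n)"
    and top_move: "\<And>n. t n \<Longrightarrow> \<not> P n \<Longrightarrow> x (Suc n) = x n - y n \<and> y (Suc n) = y n \<and>
      hu (Suc n) = hu n + hv n \<and> hv (Suc n) = hv n \<and> (P (Suc n) \<longleftrightarrow> \<not> Q n) \<and> (Q (Suc n) \<longleftrightarrow> Q n)"
    and bot_idle: "\<And>n. \<not> t n \<Longrightarrow> Q n \<Longrightarrow> x (Suc n) = x n \<and> y (Suc n) = y n \<and>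
      hu (Suc n) = hu n \<and> hv (Suc n) = hv n \<and> \<not> P (Suc n) \<and> \<not> Q (Suc n)"
    and bot_move: "\<And>n. \<not> t n \<Longrightarrow> \<not> Q n \<Longrightarrow> y (Suc n) = y n - x n \<and> x (Suc n) = x n \<and>
      hv (Suc n) = hv n + hu n \<and> hu (Suc n) = hu n \<and> (Q (Suc n) \<longleftrightarrow> \<not> P n) \<and> (P (Suc n) \<longleftrightarrow> P n)"
begin

lemma swapped: "farey_sequence L (\<lambda>n. \<not> t n) Q P hv hu y x"
  using x_pos y_pos hu_pos hv_pos top_idle top_move bot_idle bot_move area
  by unfold_locales (simp_all add: add.commute)

definition height :: "nat \<Rightarrow> nat" where
  "height n = hu n + hv n"

lemma height_pos: "height n \<ge> 1"
  using hu_pos[of n] by (simp add: height_def)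

lemma L_pos: "L > 0"
proof -
  have "real (hu 0) * y 0 > 0" "real (hv 0) * x 0 > 0"
    using x_pos[of 0] y_pos[of 0] hu_pos[of 0] hv_pos[of 0] by simp_all
  then show ?thesis using area[of 0] by linarith
qed

lemma step_mono:
  "height n \<le> height (Suc n)" "x (Suc n) \<le> x n" "y (Suc n) \<le> y n"
  using top_idle[of n] top_move[of n] bot_idle[of n] bot_move[of n] x_pos[of n] y_pos[of n]
  by (cases "t n"; cases "P n"; cases "Q n"; force simp: height_def)+

lemma height_mono: "m \<le> n \<Longrightarrow> height m \<le> height n"
  by (rule lift_Suc_mono_le[of height, OF step_mono(1)])

lemma x_antimono: "m \<le> n \<Longrightarrow> x n \<le> x m"
  by (rule lift_Suc_antimono_le[of x, OF step_mono(2)])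

lemma y_antimono: "m \<le> n \<Longrightarrow> y n \<le> y m"
  by (rule lift_Suc_antimono_le[of y, OF step_mono(3)])

text \<open>By \<open>area\<close>, \<open>L / height n\<close> is a weighted mean of
  \<open>x n\<close> and \<open>y n\<close>, and a top move requires
  \<open>y n < x n\<close>.\<close>

lemma top_move_bounds:
  assumes "t n" "\<not> P n"
  shows "y n \<le> L / height n" "L / height n \<le> x n" "height n < height (Suc n)"
proof -
  have lt: "y n < x n"
    using top_move[OF assms] x_pos[of "Suc n"] by simp
  have "real (hv n) * y n \<le> real (hv n) * x n" "real (hu n) * y n \<le> real (hu n) * x n"
    using lt by (auto intro: mult_left_mono)
  then have "real (height n) * y n \<le> L" "L \<le> real (height n) * x n"
    using area[of n] by (auto simp: height_def distrib_right)
  then show "y n \<le> L / height n" "L / height n \<le> x n"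
    using height_pos[of n] by (simp_all add: field_simps)
  show "height n < height (Suc n)"
    using top_move[OF assms] hv_pos[of n] by (simp add: height_def)
qed

lemma bot_move_bounds:
  assumes "\<not> t n" "\<not> Q n"
  shows "x n \<le> L / height n" "L / height n \<le> y n"
proof -
  interpret sw: farey_sequence L "\<lambda>n. \<not> t n" Q P hv hu y x by (rule swapped)
  show "x n \<le> L / height n" "L / height n \<le> y n"
    using sw.top_move_bounds[of n] assms by (simp_all add: sw.height_def height_def add.commute)
qed

definition both_moves :: "nat \<Rightarrow> nat \<Rightarrow> bool" where
  "both_moves m n \<longleftrightarrow> (\<exists>i\<in>{m..<n}. t i \<and> \<not> P i) \<and> (\<exists>i\<in>{m..<n}. \<not> t i \<and> \<not> Q i)"

lemma both_moves_mono: "both_moves m n \<Longrightarrow> m' \<le> m \<Longrightarrow> n \<le> n' \<Longrightarrow> both_moves m' n'"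
  unfolding both_moves_def by (meson atLeastLessThan_iff le_trans less_le_trans)

text \<open>A top move bounds \<open>y\<close> above and \<open>x\<close> below, a bottom move does
  the opposite. Monotonicity carries these bounds to the ends of a window containing both.\<close>

lemma both_moves_bounds:
  assumes "both_moves m n"
  shows "x n \<le> L / height m" "y n \<le> L / height m" "L / height n \<le> x m" "L / height n \<le> y m"
    "height m < height n"
proof -
  obtain i j where i: "m \<le> i" "i < n" "t i" "\<not> P i" and j: "m \<le> j" "j < n" "\<not> t j" "\<not> Q j"
    using assms unfolding both_moves_def by auto
  have anti: "L / height b \<le> L / height a" if "a \<le> b" for a b
    using height_mono[OF that] height_pos[of a] L_pos by (intro divide_left_mono) auto
  note bi = top_move_bounds[OF i(3,4)] and bj = bot_move_bounds[OF j(3,4)]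
  show "x n \<le> L / height m"
    using x_antimono[of j n] bj(1) anti[of m j] j by linarith
  show "y n \<le> L / height m"
    using y_antimono[of i n] bi(1) anti[of m i] i by linarith
  show "L / height n \<le> x m"
    using x_antimono[of m i] bi(2) anti[of i n] i by linarith
  show "L / height n \<le> y m"
    using y_antimono[of m j] bj(2) anti[of j n] j by linarith
  show "height m < height n"
    using height_mono[of m i] bi(3) height_mono[of "Suc i" n] i by linarith
qed

text \<open>No two consecutive steps are idle, and a move is followed by \<open>P\<close> unless the whole run is in
  the shape \<open>HeadLast\<close>; so \<open>2 * moves \<ge> k - 1 + of_bool P\<close>.\<close>

lemma top_run:
  assumes "\<And>i. m \<le> i \<Longrightarrow> i < m + k \<Longrightarrow> t i"
  shows "y (m + k) = y m \<and> hv (m + k) = hv m \<and> hu (m + k) \<le> hu m + k * hv m \<and>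
    x (m + k) \<le> x m - (real k - 1 + of_bool (P (m + k))) / 2 * y m"
  using assms
proof (induction k)
  case 0
  then show ?case using y_pos[of m] by (auto simp: of_bool_def)
next
  case (Suc k)
  then have IH: "y (m + k) = y m" "hv (m + k) = hv m" "hu (m + k) \<le> hu m + k * hv m"
    "x (m + k) \<le> x m - (real k - 1 + of_bool (P (m + k))) / 2 * y m" and t: "t (m + k)"
    by auto
  show ?case
  proof (cases "P (m + k)")
    case True
    then show ?thesis using top_idle[OF t True] IH by simp
  next
    case False
    have "x (Suc (m + k)) \<le> x m - (real k - 1) / 2 * y m - y m"
      using top_move[OF t False] IH False by simp
    also have "\<dots> = x m - (real k + 1) / 2 * y m"
      by (simp add: field_simps)
    also have "\<dots> \<le> x m - (real (Suc k) - 1 + of_bool (P (Suc (m + k)))) / 2 * y m"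
      using y_pos[of m] by (intro diff_left_mono mult_right_mono divide_right_mono) auto
    finally show ?thesis
      using top_move[OF t False] IH by simp
  qed
qed

text \<open>During a run \<open>x\<close> loses about \<open>y m / 2\<close> per step on average and
  must stay positive.\<close>

lemma top_run_length:
  assumes "\<And>i. m \<le> i \<Longrightarrow> i < m + k \<Longrightarrow> t i"
  shows "(real k - 1) * y m < 2 * x m" "height (m + k) \<le> (1 + k) * height m"
proof -
  note run = top_run[of m k, OF assms]
  have "(real k - 1) / 2 * y m \<le> (real k - 1 + of_bool (P (m + k))) / 2 * y m"
    using y_pos[of m] by (intro mult_right_mono divide_right_mono) auto
  then have "(real k - 1) / 2 * y m < x m"
    using run x_pos[of "m + k"] by linarith
  then show "(real k - 1) * y m < 2 * x m" by simp
  show "height (m + k) \<le> (1 + k) * height m"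
    using run by (auto simp: height_def algebra_simps)
qed

lemma top_run_ends: "\<exists>n\<ge>m. \<not> t n"
proof (rule ccontr)
  assume "\<not> ?thesis"
  then have *: "(real k - 1) * y m < 2 * x m" for k
    using top_run_length(1)[of m k] by auto
  obtain k where "2 * x m < real k * y m"
    using reals_Archimedean3[OF y_pos] by blast
  then show False
    using *[of "Suc k"] by simp
qed

lemma type_changes: "\<exists>n>m. t n \<noteq> t m"
proof -
  interpret sw: farey_sequence L "\<lambda>n. \<not> t n" Q P hv hu y x by (rule swapped)
  show ?thesis
    using top_run_ends[of "Suc m"] sw.top_run_ends[of "Suc m"] by (metis Suc_le_eq)
qed

end

section \<open>Maximal runs of one type\<close>

locale farey_blocks = farey_sequence +
  fixes z :: "nat \<Rightarrow> nat"
  assumes z_less: "\<And>k. z k < z (Suc k)"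
    and z_const: "\<And>k i. z k \<le> i \<Longrightarrow> i < z (Suc k) \<Longrightarrow> t i = t (z k)"
    and z_change: "\<And>k. t (z (Suc k)) \<noteq> t (z k)"
begin

lemma swapped_blocks: "farey_blocks L (\<lambda>n. \<not> t n) Q P hv hu y x z"
proof -
  interpret sw: farey_sequence L "\<lambda>n. \<not> t n" Q P hv hu y x by (rule swapped)
  show ?thesis
    using z_less z_const z_change by unfold_locales auto
qed

lemma z_mono: "j \<le> k \<Longrightarrow> z j \<le> z k"
  by (rule lift_Suc_mono_le[of z]) (auto intro: less_imp_le z_less)

definition moves :: "nat \<Rightarrow> bool" where
  "moves k \<longleftrightarrow> (\<exists>i\<in>{z k..<z (Suc k)}. if t i then \<not> P i else \<not> Q i)"

lemma moves_at_start: "(if t (z k) then \<not> P (z k) else \<not> Q (z k)) \<Longrightarrow> moves k"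
  unfolding moves_def using z_less[of k] by force

text \<open>A block without a move is a single idle step; it leads to the shape \<open>Flip\<close>, from which the
  next two blocks cannot start idle.\<close>

lemma moves_after_idle_top:
  assumes "\<not> moves k" "t (z k)"
  shows "moves (Suc k) \<and> moves (Suc (Suc k))"
proof -
  have P: "P i" if "z k \<le> i" "i < z (Suc k)" for i
    using assms z_const[OF that] that unfolding moves_def by (metis atLeastLessThan_iff)
  have idle: "\<not> P (Suc (z k))" "\<not> Q (Suc (z k))"
    using top_idle[OF assms(2)] P[of "z k"] z_less[of k] by auto
  have z1: "z (Suc k) = Suc (z k)"
    using P[of "Suc (z k)"] idle z_less[of k] by force
  have t1: "\<not> t (z (Suc k))" and t2: "t (z (Suc (Suc k)))"
    using z_change[of k] z_change[of "Suc k"] assms(2) by auto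
  \<comment> \<open>Bottom steps never create \<open>P\<close>, so its absence lasts until the next
    top block starts, which then starts with a move.\<close>
  have "\<not> P i" if "z (Suc k) \<le> i" "i \<le> z (Suc (Suc k))" for i
    using that
  proof (induction i rule: dec_induct)
    case base
    then show ?case using idle z1 by simp
  next
    case (step i)
    then have "\<not> t i" using z_const[of "Suc k" i] t1 by simp
    then show ?case using bot_idle[of i] bot_move[of i] step by (cases "Q i") auto
  qed
  then have "\<not> P (z (Suc (Suc k)))"
    using z_less[of "Suc k"] by simp
  then show ?thesis
    using moves_at_start[of "Suc k"] moves_at_start[of "Suc (Suc k)"] t1 t2 idle z1 by simp
qed

lemma moves_after_idle:
  assumes "\<not> moves k"
  shows "moves (Suc k) \<and> moves (Suc (Suc k))"
proof (cases "t (z k)")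
  case True
  then show ?thesis using moves_after_idle_top assms by blast
next
  case False
  interpret sw: farey_blocks L "\<lambda>n. \<not> t n" Q P hv hu y x z by (rule swapped_blocks)
  have "sw.moves j = moves j" for j
    by (auto simp: moves_def sw.moves_def split: if_splits)
  then show ?thesis using sw.moves_after_idle_top[of k] assms False by simp
qed

lemma both_moves_adjacent:
  assumes "moves k" "moves (Suc k)"
  shows "both_moves (z k) (z (Suc (Suc k)))"
proof -
  obtain i j where i: "z k \<le> i" "i < z (Suc k)" "if t i then \<not> P i else \<not> Q i"
    and j: "z (Suc k) \<le> j" "j < z (Suc (Suc k))" "if t j then \<not> P j else \<not> Q j"
    using assms unfolding moves_def by auto
  have ij: "t j \<noteq> t i" "i \<in> {z k..<z (Suc (Suc k))}" "j \<in> {z k..<z (Suc (Suc k))}"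
    using z_const[OF i(1,2)] z_const[OF j(1,2)] z_change[of k] i j z_less[of k] z_less[of "Suc k"] by auto
  show ?thesis
    unfolding both_moves_def using i(3) j(3) ij by (cases "t i") auto
qed

text \<open>A block without a move is followed by two blocks with moves, so among four consecutive
  blocks two adjacent ones have moves, and these are of opposite type.\<close>

lemma both_moves_blocks: "both_moves (z k) (z (k + 4))"
proof -
  have "\<exists>j. k \<le> j \<and> Suc (Suc j) \<le> k + 4 \<and> moves j \<and> moves (Suc j)"
  proof (cases "moves k")
    case True
    then show ?thesis
      using moves_after_idle[of "Suc k"]
      by (cases "moves (Suc k)") (auto intro: exI[of _ k] exI[of _ "Suc (Suc k)"])
  next
    case False
    then show ?thesis
      using moves_after_idle[of k] by (intro exI[of _ "Suc k"]) auto
  qed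
  then obtain j where j: "k \<le> j" "Suc (Suc j) \<le> k + 4" "moves j" "moves (Suc j)"
    by blast
  show ?thesis
    by (rule both_moves_mono[OF both_moves_adjacent[OF j(3,4)]]) (use j z_mono in auto)
qed

lemma block_growth:
  "height (z (Suc k)) \<le> (1 + (z (Suc k) - z k)) * height (z k)"
proof -
  interpret sw: farey_blocks L "\<lambda>n. \<not> t n" Q P hv hu y x z by (rule swapped_blocks)
  have eq: "z k + (z (Suc k) - z k) = z (Suc k)" using z_less[of k] by simp
  show ?thesis
  proof (cases "t (z k)")
    case True
    then show ?thesis
      using top_run_length(2)[of "z k" "z (Suc k) - z k"] z_const[of k] eq by auto
  next
    case False
    then show ?thesis
      using sw.top_run_length(2)[of "z k" "z (Suc k) - z k"] z_const[of k] eq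
      by (auto simp: sw.height_def height_def add.commute)
  qed
qed

lemma height_unbounded: "n \<le> height (z (4 * n))"
proof (induction n)
  case (Suc n)
  have "height (z (4 * n)) < height (z (4 * n + 4))"
    by (rule both_moves_bounds(5)[OF both_moves_blocks])
  then show ?case using Suc by (simp add: add.commute)
qed simp

lemma height_crossing:
  assumes "real (height (z k0)) \<le> M"
  obtains k where "k \<ge> k0" "real (height (z k)) \<le> M" "M < real (height (z (Suc k)))"
proof -
  obtain n where n: "M < real n" using reals_Archimedean2 by blast
  have "\<exists>k\<ge>k0. real (height (z k)) \<le> M \<and> M < real (height (z (Suc k)))"
  proof (rule ccontr)
    assume "\<not> ?thesis"
    then have step: "real (height (z k)) \<le> M \<Longrightarrow> real (height (z (Suc k))) \<le> M" if "k \<ge> k0" for k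
      using that by (meson not_less)
    have "real (height (z k)) \<le> M" if "k \<ge> k0" for k
      using that by (induction k rule: dec_induct) (use assms step in auto)
    then have "real (height (z (4 * n + k0))) \<le> M" by simp
    moreover have "n \<le> height (z (4 * n + k0))"
      using height_unbounded[of n] height_mono[OF z_mono[of "4 * n" "4 * n + k0"]] by simp
    ultimately show False using n by linarith
  qed
  then show ?thesis using that by blast
qed

end

section \<open>Return exponents\<close>

text \<open>Composing steps multiplies the exponents, but each can be taken as close to 1 as
  desired.\<close>

lemma iterated_growth:
  fixes f :: "nat \<Rightarrow> real"
  assumes f: "\<And>k. f k \<ge> 1"
    and growth: "\<And>\<epsilon>. \<epsilon> > 0 \<Longrightarrow> \<exists>C>0. \<forall>k\<ge>1. f (Suc k) \<le> C * f k powr (1 + \<epsilon>)"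
    and "\<epsilon> > 0"
  shows "\<exists>C>0. \<forall>k\<ge>1. f (k + j) \<le> C * f k powr (1 + \<epsilon>)"
  using \<open>\<epsilon> > 0\<close>
proof (induction j arbitrary: \<epsilon>)
  case 0
  have "f k \<le> 1 * f k powr (1 + \<epsilon>)" for k
    using powr_mono[of 1 "1 + \<epsilon>" "f k"] f[of k] 0 by simp
  then show ?case by (intro exI[of _ 1]) auto
next
  case (Suc j)
  \<comment> \<open>From \<open>\<delta> \<le> 1\<close> the square of \<open>1 + \<delta>\<close>
    is at most \<open>1 + 3 * \<delta>\<close>.\<close>
  define \<delta> where "\<delta> = min 1 (\<epsilon> / 3)"
  have \<delta>: "\<delta> > 0" "\<delta> \<le> 1" "3 * \<delta> \<le> \<epsilon>" using Suc.prems by (auto simp: \<delta>_def)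
  have "\<delta> * \<delta> \<le> 1 * \<delta>" using \<delta> by (intro mult_right_mono) auto
  moreover have "(1 + \<delta>) * (1 + \<delta>) = 1 + 2 * \<delta> + \<delta> * \<delta>" by (simp add: algebra_simps)
  ultimately have exps: "(1 + \<delta>) * (1 + \<delta>) \<le> 1 + \<epsilon>" using \<delta> by linarith
  obtain C1 where C1: "C1 > 0" "\<And>k. k \<ge> 1 \<Longrightarrow> f (k + j) \<le> C1 * f k powr (1 + \<delta>)"
    using Suc.IH[OF \<delta>(1)] by auto
  obtain C2 where C2: "C2 > 0" "\<And>k. k \<ge> 1 \<Longrightarrow> f (Suc k) \<le> C2 * f k powr (1 + \<delta>)"
    using growth[OF \<delta>(1)] by auto
  have "f (k + Suc j) \<le> C2 * C1 powr (1 + \<delta>) * f k powr (1 + \<epsilon>)" if "k \<ge> 1" for k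
  proof -
    have "f (k + Suc j) \<le> C2 * f (k + j) powr (1 + \<delta>)"
      using C2(2)[of "k + j"] that by simp
    also have "\<dots> \<le> C2 * (C1 * f k powr (1 + \<delta>)) powr (1 + \<delta>)"
      using C2(1) C1(2)[OF that] f[of "k + j"] \<delta> by (intro mult_left_mono powr_mono2) auto
    also have "\<dots> = C2 * C1 powr (1 + \<delta>) * f k powr ((1 + \<delta>) * (1 + \<delta>))"
      using C1(1) by (simp add: powr_mult powr_powr)
    also have "\<dots> \<le> C2 * C1 powr (1 + \<delta>) * f k powr (1 + \<epsilon>)"
      using C2(1) exps f[of k] by (intro mult_left_mono powr_mono) auto
    finally show ?thesis .
  qed
  then show ?case
    using C1(1) C2(1) by (intro exI[of _ "C2 * C1 powr (1 + \<delta>)"]) auto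
qed

context farey_blocks
begin

text \<open>Choose \<open>k\<close> with \<open>f k \<le> L / r < f (k + 1)\<close>. At block
  \<open>k + 5\<close> both displacements are below \<open>r\<close>, at block \<open>k - 4\<close>
  both are at least \<open>r\<close>, so \<open>\<tau>\<close> lies between the corresponding
  heights up to a factor 2. By the growth hypothesis both heights are near \<open>1 / r\<close> on
  the logarithmic scale.\<close>

theorem uniform_return_exponent:
  fixes \<tau> :: "real \<Rightarrow> real \<Rightarrow> nat"
  assumes growth: "\<And>\<epsilon>. \<epsilon> > 0 \<Longrightarrow>
      \<exists>C>0. \<forall>k\<ge>1. real (height (z (Suc k))) \<le> C * real (height (z k)) powr (1 + \<epsilon>)"
    and r0: "r0 > 0"
    and upper: "\<And>n r p. p \<in> S \<Longrightarrow> r \<le> r0 \<Longrightarrow> x n < r \<Longrightarrow> y n < r \<Longrightarrow> \<tau> r p \<in> {1..height n}"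
    and lower: "\<And>n r p. p \<in> S \<Longrightarrow> 0 < r \<Longrightarrow> r \<le> r0 \<Longrightarrow> r \<le> x n \<Longrightarrow> r \<le> y n \<Longrightarrow> height n \<le> 2 * \<tau> r p"
  shows "uniform_limit S (\<lambda>r p. ln (real (\<tau> r p)) / (- ln r)) (\<lambda>p. 1) (at_right 0)"
proof (rule uniform_limitI)
  fix e :: real
  assume "e > 0"
  define \<epsilon> where "\<epsilon> = e / 2"
  have \<epsilon>: "\<epsilon> > 0" using \<open>e > 0\<close> by (simp add: \<epsilon>_def)
  define f where "f k = real (height (z k))" for k
  have f1: "f k \<ge> 1" for k using height_pos[of "z k"] by (simp add: f_def)
  \<comment> \<open>A span of five blocks serves twice: from \<open>k\<close> to
    \<open>k + 5\<close> and from \<open>k - 4\<close> to \<open>k + 1\<close>.\<close>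
  obtain C where C: "C > 0" "\<And>k. k \<ge> 1 \<Longrightarrow> f (k + 5) \<le> C * f k powr (1 + \<epsilon>)"
    using iterated_growth[of f \<epsilon> 5] f1 growth \<epsilon> unfolding f_def by blast
  \<comment> \<open>\<open>A\<close> and \<open>B\<close> collect the constants in the logarithms of
    the upper and the lower estimate; both are eventually below
    \<open>\<epsilon> * (- ln r)\<close>.\<close>
  define A where "A = ln C + (1 + \<epsilon>) * ln L"
  define B where "B = ln C + (1 + \<epsilon>) * ln 2 - ln L"
  have "filterlim (\<lambda>r::real. - ln r) at_top (at_right 0)"
    using ln_at_0 by (simp add: filterlim_uminus_at_bot)
  then have "\<forall>\<^sub>F r::real in at_right 0. - ln r > max 0 (max (A / \<epsilon>) (B / \<epsilon>))"
    unfolding filterlim_at_top_dense by blast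
  \<comment> \<open>The bound \<open>L / f 5\<close> forces \<open>k \<ge> 5\<close>, so that block
    \<open>k - 4\<close> has index at least 1.\<close>
  moreover have "\<forall>\<^sub>F r::real in at_right 0. 0 < r \<and> r < min r0 (L / f 5)"
    using r0 L_pos f1[of 5] by (intro eventually_at_rightI[of 0 "min r0 (L / f 5)"]) auto
  ultimately show "\<forall>\<^sub>F r in at_right 0. \<forall>p\<in>S. dist (ln (real (\<tau> r p)) / (- ln r)) 1 < e"
  proof eventually_elim
    case (elim r)
    define l where "l = - ln r"
    have r: "0 < r" "r \<le> r0" and l: "l > 0" "A < \<epsilon> * l" "B < \<epsilon> * l"
      using elim \<epsilon> by (auto simp: l_def field_simps)
    have "f 5 \<le> L / r" using elim f1[of 5] by (auto simp: field_simps)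
    then obtain k where k: "k \<ge> 5" "f k \<le> L / r" "L / r < f (Suc k)"
      using height_crossing[of 5 "L / r"] unfolding f_def by blast
    have lnLr: "ln (L / r) = ln L + l"
      using L_pos r by (simp add: ln_div l_def)
    show ?case
    proof
      fix p assume p: "p \<in> S"
      have "L / f (Suc k) < r"
        using k(3) r f1[of "Suc k"] by (simp add: field_simps)
      moreover have "both_moves (z (Suc k)) (z (k + 5))"
        using both_moves_blocks[of "Suc k"] by (simp add: add.commute)
      ultimately have "\<tau> r p \<in> {1..height (z (k + 5))}"
        using both_moves_bounds(1,2)[of "z (Suc k)" "z (k + 5)"] p r
        by (intro upper) (auto simp: f_def)
      then have \<tau>: "1 \<le> real (\<tau> r p)" "real (\<tau> r p) \<le> f (k + 5)"
        by (auto simp: f_def)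
      have "real (\<tau> r p) \<le> C * (L / r) powr (1 + \<epsilon>)"
      proof -
        have "f (k + 5) \<le> C * f k powr (1 + \<epsilon>)" using C(2) k(1) by simp
        also have "\<dots> \<le> C * (L / r) powr (1 + \<epsilon>)"
          using C(1) k(2) f1[of k] \<epsilon> by (intro mult_left_mono powr_mono2) auto
        finally show ?thesis using \<tau> by simp
      qed
      then have "ln (real (\<tau> r p)) \<le> ln (C * (L / r) powr (1 + \<epsilon>))"
        using \<tau> by (intro ln_mono) auto
      also have "\<dots> = A + (1 + \<epsilon>) * l"
        using C(1) L_pos r lnLr by (simp add: ln_mult ln_powr A_def algebra_simps)
      finally have up: "ln (real (\<tau> r p)) < (1 + e) * l"
        using l by (simp add: \<epsilon>_def algebra_simps)
      define j where "j = k - 4"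
      have j: "j \<ge> 1" "k = j + 4" "Suc k = j + 5" using k(1) by (auto simp: j_def)
      have "r \<le> L / f k"
        using k(2) r f1[of k] by (simp add: field_simps)
      then have "height (z j) \<le> 2 * \<tau> r p"
        using both_moves_bounds(3,4)[OF both_moves_blocks[of j]] p r j
        by (intro lower) (auto simp: f_def)
      then have low: "f j \<le> 2 * real (\<tau> r p)" unfolding f_def by linarith
      have "L / r \<le> C * f j powr (1 + \<epsilon>)"
        using k(3) j(3) C(2)[OF j(1)] by simp
      also have "\<dots> \<le> C * (2 * real (\<tau> r p)) powr (1 + \<epsilon>)"
        using C(1) low f1[of j] \<epsilon> by (intro mult_left_mono powr_mono2) auto
      finally have "ln (L / r) \<le> ln (C * (2 * real (\<tau> r p)) powr (1 + \<epsilon>))"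
        using L_pos r by (intro ln_mono) auto
      also have "\<dots> = ln C + (1 + \<epsilon>) * ln 2 + (1 + \<epsilon>) * ln (real (\<tau> r p))"
        using C(1) \<tau> by (simp add: ln_mult ln_powr algebra_simps)
      finally have "(1 - \<epsilon>) * l < (1 + \<epsilon>) * ln (real (\<tau> r p))"
        using l lnLr by (simp add: B_def algebra_simps)
      moreover have "(1 + \<epsilon>) * ((1 - e) * l) \<le> (1 - \<epsilon>) * l"
      proof -
        have "(1 + \<epsilon>) * (1 - e) \<le> 1 - \<epsilon>"
          using \<epsilon> by (simp add: \<epsilon>_def field_simps)
        then show ?thesis using l(1) by (metis mult.assoc less_imp_le mult_right_mono)
      qed
      ultimately have "(1 + \<epsilon>) * ((1 - e) * l) < (1 + \<epsilon>) * ln (real (\<tau> r p))"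
        by linarith
      then have "(1 - e) * l < ln (real (\<tau> r p))"
        using \<epsilon> by (simp add: mult_less_cancel_left_pos)
      then show "dist (ln (real (\<tau> r p)) / (- ln r)) 1 < e"
        using up l(1) unfolding l_def[symmetric] dist_real_def
        by (simp add: abs_less_iff field_simps)
    qed
  qed
qed

end

section \<open>Block lengths recovered from return times\<close>

context farey_sequence
begin

text \<open>Taking \<open>r = 2 * y\<close> at the start of a run of length \<open>k\<close> makes the return time at most \<open>hv\<close>
  while \<open>1 / r\<close> is at least of order \<open>k * hv\<close>.\<close>

lemma top_run_bound:
  fixes \<tau> :: "real \<Rightarrow> nat"
  assumes "\<epsilon> > 0" and r1: "r1 > 0" "r1 \<le> 1" and p0: "p0 > 0"
    and ratio: "\<And>r. 0 < r \<Longrightarrow> r < r1 \<Longrightarrow> 1 / (1 + \<epsilon>) < ln (real (\<tau> r)) / (- ln r)"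
    and ret: "\<And>n r. y n < r \<Longrightarrow> y n < p0 \<Longrightarrow> \<tau> r \<in> {1..hv n}"
  shows "\<exists>C>0. \<forall>m k. (\<forall>i\<in>{m..<m + k}. t i) \<longrightarrow> real k \<le> C * real (height m) powr \<epsilon>"
proof -
  define r2 where "r2 = min r1 p0"
  have r2: "r2 > 0" "r2 \<le> r1" "r2 \<le> p0" using r1 p0 by (auto simp: r2_def)
  \<comment> \<open>The term 1 pays for \<open>k - 1\<close> in place of \<open>k\<close>, the term
    \<open>4 * L / r2\<close> covers a displacement \<open>y m\<close> that is not small, and
    \<open>4 * L\<close> covers the case where the return estimate applies.\<close>
  have "real k \<le> (1 + 4 * L + 4 * L / r2) * real (height m) powr \<epsilon>"
    if run: "\<forall>i\<in>{m..<m + k}. t i" for m k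
  proof -
    have Nm: "1 \<le> real (height m) powr \<epsilon>"
      using height_pos[of m] \<open>\<epsilon> > 0\<close> by (intro ge_one_powr_ge_zero) auto
    have h1: "(real k - 1) * y m < 2 * x m"
      using top_run_length(1)[of m k] run by auto
    have h2: "real (hv m) * x m \<le> L"
      using area[of m] y_pos[of m] hu_pos[of m] by (smt (verit) mult_nonneg_nonneg of_nat_0_le_iff)
    have "1 * x m \<le> real (hv m) * x m"
      using hv_pos[of m] x_pos[of m] by (intro mult_right_mono) auto
    then have xL: "x m \<le> L" using h2 by linarith
    have "real k - 1 \<le> (4 * L + 4 * L / r2) * real (height m) powr \<epsilon>"
    proof (cases "2 * y m < r2")
      case False
      have "(real k - 1) * y m < 2 * L" using h1 xL by linarith
      then have "real k - 1 < 2 * L / y m" using y_pos[of m] by (simp add: field_simps)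
      also have "\<dots> \<le> 2 * L / (r2 / 2)"
        using False r2 L_pos y_pos[of m] by (intro divide_left_mono) auto
      also have "\<dots> \<le> (4 * L + 4 * L / r2) * 1" using L_pos by simp
      also have "\<dots> \<le> (4 * L + 4 * L / r2) * real (height m) powr \<epsilon>"
        using Nm L_pos r2 by (intro mult_left_mono) auto
      finally show ?thesis by simp
    next
      case True
      define r where "r = 2 * y m"
      have r: "0 < r" "r < r1" "y m < r" "y m < p0" "r < 1"
        using True r2 r1 y_pos[of m] by (auto simp: r_def)
      have \<tau>: "1 \<le> \<tau> r" "\<tau> r \<le> hv m" using ret[OF r(3,4)] by auto
      have "- ln r < (1 + \<epsilon>) * ln (real (\<tau> r))"
        using ratio[OF r(1,2)] r \<open>\<epsilon> > 0\<close> by (simp add: field_simps)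
      also have "\<dots> \<le> (1 + \<epsilon>) * ln (real (hv m))"
        using \<tau> \<open>\<epsilon> > 0\<close> by (intro mult_left_mono) auto
      finally have "ln (1 / r) < ln (real (hv m) powr (1 + \<epsilon>))"
        using r hv_pos[of m] by (simp add: ln_div ln_powr)
      then have inv: "1 / r < real (hv m) powr (1 + \<epsilon>)"
        using r hv_pos[of m] by (subst (asm) ln_less_cancel_iff) auto
      have "(real k - 1) * y m * real (hv m) \<le> 2 * x m * real (hv m)"
        using h1 by (intro mult_right_mono) auto
      then have "(real k - 1) * real (hv m) \<le> 4 * L * (1 / r)"
        using h2 y_pos[of m] by (simp add: r_def field_simps)
      also have "\<dots> \<le> 4 * L * (real (hv m) powr \<epsilon> * real (hv m))"
        using inv L_pos hv_pos[of m] by (intro mult_left_mono) (auto simp: powr_add mult.commute)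
      finally have "(real k - 1) * real (hv m) \<le> (4 * L * real (hv m) powr \<epsilon>) * real (hv m)"
        by (simp add: mult.assoc)
      then have "real k - 1 \<le> 4 * L * real (hv m) powr \<epsilon>"
        using hv_pos[of m] by (subst (asm) mult_le_cancel_right) auto
      also have "\<dots> \<le> 4 * L * real (height m) powr \<epsilon>"
        using L_pos \<open>\<epsilon> > 0\<close> by (intro mult_left_mono powr_mono2) (auto simp: height_def)
      also have "\<dots> \<le> (4 * L + 4 * L / r2) * real (height m) powr \<epsilon>"
        using L_pos r2 by (intro mult_right_mono) auto
      finally show ?thesis .
    qed
    then show ?thesis using Nm by (simp add: algebra_simps)
  qed
  moreover have "1 + 4 * L + 4 * L / r2 > 0"
    using L_pos r2 by (simp add: add_pos_pos)
  ultimately show ?thesis by blast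
qed

end

context farey_blocks
begin

text \<open>A block is a run of top or of bottom steps: \<open>top_run_bound\<close> applies to the
  sequence itself or to the swapped one.\<close>

theorem block_length_bound:
  fixes \<tau> :: "real \<Rightarrow> nat"
  assumes "\<epsilon> > 0" and p0: "p0 > 0"
    and lim: "((\<lambda>r. ln (real (\<tau> r)) / (- ln r)) \<longlongrightarrow> 1) (at_right 0)"
    and ret_y: "\<And>n r. y n < r \<Longrightarrow> y n < p0 \<Longrightarrow> \<tau> r \<in> {1..hv n}"
    and ret_x: "\<And>n r. x n < r \<Longrightarrow> x n < p0 \<Longrightarrow> \<tau> r \<in> {1..hu n}"
  shows "\<exists>C>0. \<forall>k. real (z (Suc k) - z k) \<le> C * real (height (z k)) powr \<epsilon>"
proof -
  interpret sw: farey_blocks L "\<lambda>n. \<not> t n" Q P hv hu y x z by (rule swapped_blocks)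
  have swh: "sw.height n = height n" for n by (simp add: sw.height_def height_def add.commute)
  have "\<forall>\<^sub>F r in at_right 0. 1 / (1 + \<epsilon>) < ln (real (\<tau> r)) / (- ln r)"
    using \<open>\<epsilon> > 0\<close> by (intro order_tendstoD(1)[OF lim]) (simp add: field_simps)
  then obtain b where b: "b > 0" "\<And>r. 0 < r \<Longrightarrow> r < b \<Longrightarrow> 1 / (1 + \<epsilon>) < ln (real (\<tau> r)) / (- ln r)"
    unfolding eventually_at_right_field by auto
  define r1 where "r1 = min b 1"
  have r1: "r1 > 0" "r1 \<le> 1" "\<And>r. 0 < r \<Longrightarrow> r < r1 \<Longrightarrow> 1 / (1 + \<epsilon>) < ln (real (\<tau> r)) / (- ln r)"
    using b by (auto simp: r1_def)
  obtain C1 where C1: "C1 > 0" "\<And>m k. (\<forall>i\<in>{m..<m + k}. t i) \<Longrightarrow> real k \<le> C1 * real (height m) powr \<epsilon>"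
    using top_run_bound[OF \<open>\<epsilon> > 0\<close> r1(1,2) p0 r1(3) ret_y] by blast
  obtain C2 where C2: "C2 > 0" "\<And>m k. (\<forall>i\<in>{m..<m + k}. \<not> t i) \<Longrightarrow> real k \<le> C2 * real (height m) powr \<epsilon>"
    using sw.top_run_bound[OF \<open>\<epsilon> > 0\<close> r1(1,2) p0 r1(3) ret_x] unfolding swh by blast
  have "real (z (Suc k) - z k) \<le> (C1 + C2) * real (height (z k)) powr \<epsilon>" for k
  proof -
    have eq: "z k + (z (Suc k) - z k) = z (Suc k)" using z_less[of k] by simp
    have "real (z (Suc k) - z k) \<le> C1 * real (height (z k)) powr \<epsilon> \<or>
          real (z (Suc k) - z k) \<le> C2 * real (height (z k)) powr \<epsilon>"
      using C1(2)[of "z k" "z (Suc k) - z k"] C2(2)[of "z k" "z (Suc k) - z k"] z_const[of k] eq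
      by (cases "t (z k)") auto
    moreover have "C1 * real (height (z k)) powr \<epsilon> \<ge> 0" "C2 * real (height (z k)) powr \<epsilon> \<ge> 0"
      using C1(1) C2(1) by auto
    ultimately show ?thesis by (auto simp: distrib_right)
  qed
  then show ?thesis using C1(1) C2(1) by (intro exI[of _ "C1 + C2"]) auto
qed

end

section \<open>Three-interval exchanges with the Keane property\<close>

text \<open>A step keeps the row in which its winner is last, so the same letter wins again when the
  type repeats. Otherwise the next winner is the last letter of the other row, a different
  letter.\<close>

lemma winner_rauzy_step:
  assumes "has_shape s (rauzy_step D) a b c"
  shows "winner (rauzy_step D) = winner D \<longleftrightarrow> top_type (rauzy_step D) = top_type D"
proof -
  have ne: "last_top (rauzy_step D) \<noteq> last_bot (rauzy_step D)"
    using has_shape_last[OF assms] has_shapeD[OF assms] by (simp add: bot_last_def)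
  have "last_top (rauzy_step D) = last_top D" if "top_type D"
    using rauzy_step_top_pos[OF that] by (simp add: last_top_def)
  moreover have "last_bot (rauzy_step D) = last_bot D" if "\<not> top_type D"
    using rauzy_step_bot_pos[OF that] by (simp add: last_bot_def)
  ultimately show ?thesis
    using ne unfolding winner_def by (cases "top_type D"; cases "top_type (rauzy_step D)") auto
qed

text \<open>The row of the constant winner never changes and keeps sum 1, so each step adds exactly
  1 to the total.\<close>

lemma Q_matrix_same_winner:
  fixes D :: "'a::finite iet_data"
  assumes "m \<le> n"
    and "\<And>i. m \<le> i \<Longrightarrow> i < n \<Longrightarrow> winner (rauzy_iter D i) = w \<and> loser (rauzy_iter D i) \<noteq> w"
  shows "row_sum (Q_matrix D m n) w = 1 \<and>
    (\<Sum>i\<in>UNIV. row_sum (Q_matrix D m n) i) = CARD('a) + real (n - m)"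
  using assms
proof (induction n rule: dec_induct)
  case base
  have "Q_matrix D m m = mat 1" by (cases m) auto
  then show ?case by (simp add: row_sum_def mat_def)
next
  case (step n)
  have w: "winner (rauzy_iter D n) = w" "loser (rauzy_iter D n) \<noteq> w"
    using step by auto
  have IH: "row_sum (Q_matrix D m n) w = 1"
    "(\<Sum>i\<in>UNIV. row_sum (Q_matrix D m n) i) = CARD('a) + real (n - m)"
    using step by auto
  show ?case
    using w IH step(1) by (simp add: row_sum_step_matrix sum.distrib Suc_diff_le)
qed

section \<open>The Farey sequence of a Keane exchange and its Zorich blocks\<close>

locale keane_three_iet =
  fixes D :: "'a::finite iet_data" and s a b c
  assumes shape: "has_shape s D a b c" and keane: "keane D" and total: "total_len D = 1"
begin

definition "\<beta> = right_move s D b c"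
definition "L = right_move s D b c + left_move s D a b"

definition "sh n = fst (farey_path D s n)"
definition "hu n = fst (snd (farey_path D s n))"
definition "hv n = fst (snd (snd (farey_path D s n)))"
definition "ku n = fst (snd (snd (snd (farey_path D s n))))"
definition "kv n = snd (snd (snd (snd (farey_path D s n))))"
text \<open>Written in integer coordinates, so that the recursion follows from
  \<open>farey_step\<close> alone; the identification with lengths supplies positivity.\<close>

definition "x n = real (hu n) * \<beta> - of_int (ku n) * L"
definition "y n = of_int (kv n) * L - real (hv n) * \<beta>"
definition "t n = top_type (rauzy_iter D n)"

lemma path_eq: "farey_path D s n = (sh n, hu n, hv n, ku n, kv n)"
  by (simp add: sh_def hu_def hv_def ku_def kv_def)

lemma state: "farey_state \<beta> L (rauzy_iter D n) (row_sum (Q_matrix D 0 n)) (sh n, hu n, hv n, ku n, kv n)"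
proof -
  note g = keane_generic[OF shape keane \<beta>_def L_def]
  show ?thesis
    unfolding path_eq[symmetric]
    by (rule farey_path_state[OF shape g(1) \<beta>_def L_def g(2)])
qed

lemma step: "(sh (Suc n), hu (Suc n), hv (Suc n), ku (Suc n), kv (Suc n)) =
    farey_step (t n) (sh n, hu n, hv n, ku n, kv n)"
  using farey_path.simps(2)[of D s n] by (simp only: path_eq t_def)

lemma shape_exists: "\<exists>a b c. has_shape (sh n) (rauzy_iter D n) a b c"
  using state[of n] by auto

text \<open>For the norm bounds: the rows of \<open>a\<close> and \<open>c\<close> together
  contribute between half the height and the height, and the middle row at most the height.\<close>

lemma state_facts:
  shows "hu n \<ge> 1" "hv n \<ge> 1" "int (hu n) * kv n - int (hv n) * ku n = 1" "x n > 0" "y n > 0"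
    "matrix_norm (Q_matrix D 0 n) \<le> 2 * real (hu n + hv n)"
    "real (hu n + hv n) \<le> 2 * matrix_norm (Q_matrix D 0 n)"
proof -
  obtain a b c where sh: "has_shape (sh n) (rauzy_iter D n) a b c"
    and h: "hu n \<ge> 1" "hv n \<ge> 1" "int (hu n) * kv n - int (hv n) * ku n = 1"
    and m: "right_move (sh n) (rauzy_iter D n) b c = x n" "left_move (sh n) (rauzy_iter D n) a b = y n"
    and R: "row_sum (Q_matrix D 0 n) a \<in> {real (hu n) / 2..real (hu n)}"
      "row_sum (Q_matrix D 0 n) c \<in> {real (hv n) / 2..real (hv n)}"
      "row_sum (Q_matrix D 0 n) b \<in>
        {real (mid_height (sh n) (hu n) (hv n)) / 2..real (mid_height (sh n) (hu n) (hv n))}"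
    using state[of n] by (auto simp: x_def y_def)
  show "hu n \<ge> 1" "hv n \<ge> 1" "int (hu n) * kv n - int (hv n) * ku n = 1"
    by fact+
  show "x n > 0" "y n > 0"
    using has_shapeD[OF sh] unfolding m[symmetric] right_move_def left_move_def by auto
  have "matrix_norm (Q_matrix D 0 n) = row_sum (Q_matrix D 0 n) a + row_sum (Q_matrix D 0 n) b
      + row_sum (Q_matrix D 0 n) c"
    using matrix_norm_nonneg_rows[of "Q_matrix D 0 n"] Q_matrix_nonneg[of D 0 n] has_shape_sum[OF sh]
    by simp
  moreover have "mid_height (sh n) (hu n) (hv n) \<le> hu n + hv n"
    by (auto simp: mid_height_def split: shape.split)
  ultimately show "matrix_norm (Q_matrix D 0 n) \<le> 2 * real (hu n + hv n)"
    "real (hu n + hv n) \<le> 2 * matrix_norm (Q_matrix D 0 n)"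
    using R by auto
qed

sublocale farey_sequence L t "\<lambda>n. sh n = TailFirst" "\<lambda>n. sh n = HeadLast" hu hv x y
proof
  fix n
  show "x n > 0" "y n > 0" "hu n \<ge> 1" "hv n \<ge> 1"
    by (rule state_facts)+
  have "real (hu n) * y n + real (hv n) * x n = of_int (int (hu n) * kv n - int (hv n) * ku n) * L"
    by (simp add: x_def y_def algebra_simps)
  then show "real (hu n) * y n + real (hv n) * x n = L"
    using state_facts(3)[of n] by simp
  show "x (Suc n) = x n \<and> y (Suc n) = y n \<and> hu (Suc n) = hu n \<and> hv (Suc n) = hv n \<and>
      sh (Suc n) \<noteq> TailFirst \<and> sh (Suc n) \<noteq> HeadLast" if "t n" "sh n = TailFirst"
    using step[of n] that by (simp add: x_def y_def idle_def)
  show "x (Suc n) = x n - y n \<and> y (Suc n) = y n \<and> hu (Suc n) = hu n + hv n \<and> hv (Suc n) = hv n \<and>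
      (sh (Suc n) = TailFirst) = (sh n \<noteq> HeadLast) \<and> (sh (Suc n) = HeadLast) = (sh n = HeadLast)"
    if "t n" "sh n \<noteq> TailFirst"
    using step[of n] that by (cases "sh n") (simp_all add: x_def y_def idle_def algebra_simps)
  show "x (Suc n) = x n \<and> y (Suc n) = y n \<and> hu (Suc n) = hu n \<and> hv (Suc n) = hv n \<and>
      sh (Suc n) \<noteq> TailFirst \<and> sh (Suc n) \<noteq> HeadLast" if "\<not> t n" "sh n = HeadLast"
    using step[of n] that by (simp add: x_def y_def idle_def)
  show "y (Suc n) = y n - x n \<and> x (Suc n) = x n \<and> hv (Suc n) = hv n + hu n \<and> hu (Suc n) = hu n \<and>
      (sh (Suc n) = HeadLast) = (sh n \<noteq> TailFirst) \<and> (sh (Suc n) = TailFirst) = (sh n = TailFirst)"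
    if "\<not> t n" "sh n \<noteq> HeadLast"
    using step[of n] that by (cases "sh n") (simp_all add: x_def y_def idle_def algebra_simps)
qed

lemma winner_Suc: "winner (rauzy_iter D (Suc n)) = winner (rauzy_iter D n) \<longleftrightarrow> t (Suc n) = t n"
proof -
  have "rauzy_iter D (Suc n) = rauzy_step (rauzy_iter D n)" by (simp add: rauzy_iter_def)
  then show ?thesis
    using winner_rauzy_step[of _ "rauzy_iter D n"] shape_exists[of "Suc n"] by (auto simp: t_def)
qed

text \<open>\<open>winner_Suc\<close> compares only neighbouring steps; chaining it turns equality
  of winners into constancy of the type.\<close>

lemma same_winner_iff: "same_winner D m n \<longleftrightarrow> (\<forall>i\<in>{m..<n}. t i = t m)"
proof
  assume sw: "same_winner D m n"
  have "t i = t m" if "m \<le> i" "i < n" for i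
    using that
  proof (induction i rule: dec_induct)
    case (step i)
    then have "winner (rauzy_iter D (Suc i)) = winner (rauzy_iter D i)"
      using sw unfolding same_winner_def by simp
    then show ?case using step winner_Suc[of i] by simp
  qed simp
  then show "\<forall>i\<in>{m..<n}. t i = t m" by (metis atLeastLessThan_iff)
next
  assume const: "\<forall>i\<in>{m..<n}. t i = t m"
  have "winner (rauzy_iter D i) = winner (rauzy_iter D m)" if "m \<le> i" "i < n" for i
    using that
  proof (induction i rule: dec_induct)
    case (step i)
    have "t (Suc i) = t m" using const step by (metis atLeastLessThan_iff le_SucI)
    moreover have "t i = t m" using const step by (metis atLeastLessThan_iff Suc_lessD)
    ultimately show ?case using step winner_Suc[of i] by simp
  qed simp
  then show "same_winner D m n" unfolding same_winner_def by (metis atLeastLessThan_iff)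
qed

text \<open>The range in \<open>same_winner\<close> is half-open, so the greatest end of a run is
  the first index of the other type. It exists by \<open>type_changes\<close>.\<close>

lemma zorich_time_Suc:
  defines "m k \<equiv> zorich_time D k"
  shows "m k < m (Suc k)" "\<And>i. m k \<le> i \<Longrightarrow> i < m (Suc k) \<Longrightarrow> t i = t (m k)" "t (m (Suc k)) \<noteq> t (m k)"
proof -
  define n where "n = (LEAST n. n > m k \<and> t n \<noteq> t (m k))"
  have n: "n > m k" "t n \<noteq> t (m k)"
    using LeastI_ex[of "\<lambda>n. n > m k \<and> t n \<noteq> t (m k)"] type_changes[of "m k"] unfolding n_def by auto
  have const: "t i = t (m k)" if "m k \<le> i" "i < n" for i
    using not_less_Least[of i "\<lambda>n. n > m k \<and> t n \<noteq> t (m k)"] that unfolding n_def[symmetric]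
    by (metis le_neq_implies_less)
  have "m (Suc k) = (GREATEST n. n > m k \<and> same_winner D (m k) n)"
    by (simp add: m_def)
  also have "\<dots> = n"
  proof (rule Greatest_equality)
    show "n > m k \<and> same_winner D (m k) n"
      using n(1) const unfolding same_winner_iff by (metis atLeastLessThan_iff)
    fix i assume "i > m k \<and> same_winner D (m k) i"
    then show "i \<le> n"
      using n unfolding same_winner_iff by (metis atLeastLessThan_iff less_imp_le not_le)
  qed
  finally have "m (Suc k) = n" .
  then show "m k < m (Suc k)" "\<And>i. m k \<le> i \<Longrightarrow> i < m (Suc k) \<Longrightarrow> t i = t (m k)"
    "t (m (Suc k)) \<noteq> t (m k)"
    using n const by metis+
qed

sublocale farey_blocks L t "\<lambda>n. sh n = TailFirst" "\<lambda>n. sh n = HeadLast" hu hv x y "zorich_time D"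
  by unfold_locales (rule zorich_time_Suc | assumption)+

declare zorich_time.simps(2) [simp del]

abbreviation "Zt \<equiv> zorich_time D"

lemma norm_Z_0:
  "matrix_norm (Z_matrix D 0 k) \<le> 2 * real (height (Zt k))"
  "real (height (Zt k)) \<le> 2 * matrix_norm (Z_matrix D 0 k)"
  using state_facts(6,7)[of "Zt k"] by (simp_all add: Z_matrix_def height_def)

lemma norm_Z_block: "matrix_norm (Z_matrix D k (k + 1)) = 3 + real (Zt (Suc k) - Zt k)"
proof -
  have same: "same_winner D (Zt k) (Zt (Suc k))"
    unfolding same_winner_iff using z_const[of k] by (metis atLeastLessThan_iff)
  have "winner (rauzy_iter D i) = winner (rauzy_iter D (Zt k)) \<and>
      loser (rauzy_iter D i) \<noteq> winner (rauzy_iter D (Zt k))" if "Zt k \<le> i" "i < Zt (Suc k)" for i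
  proof -
    have "winner (rauzy_iter D i) = winner (rauzy_iter D (Zt k))"
      using same that z_less[of k] unfolding same_winner_def by (meson atLeastLessThan_iff order_refl)
    moreover have "loser (rauzy_iter D i) \<noteq> winner (rauzy_iter D i)"
    proof -
      obtain a b c where sh: "has_shape (sh i) (rauzy_iter D i) a b c" using shape_exists by blast
      show ?thesis
        using winner_loser_shape[OF sh] has_shapeD[OF sh] by (simp add: bot_last_def)
    qed
    ultimately show ?thesis by simp
  qed
  then have "(\<Sum>i\<in>UNIV. row_sum (Q_matrix D (Zt k) (Zt (Suc k))) i) = CARD('a) + real (Zt (Suc k) - Zt k)"
    using Q_matrix_same_winner[of "Zt k" "Zt (Suc k)" D] z_less[of k] by (meson less_imp_le)
  then show ?thesis
    using has_shape_card[OF shape]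
    by (simp add: Z_matrix_def matrix_norm_nonneg_rows Q_matrix_nonneg)
qed

section \<open>Return times of the exchange\<close>

lemma return_time_LEAST:
  "return_time D r p = (LEAST j. j \<ge> 1 \<and> \<bar>(iet D ^^ j) p - p\<bar> < r)"
  by (simp add: return_time_def)

sublocale rot: induced_rotation "iet D" \<beta> L 1
  using induced_rotation_iet[OF shape] unfolding \<beta>_def L_def total .

lemma return_left:
  assumes "0 \<le> p" "p < 1" "y n < r" "y n \<le> p"
  shows "return_time D r p \<in> {1..hv n}"
  unfolding return_time_LEAST
proof (rule rot.return_le)
  have "real (hv n) * \<beta> - of_int (kv n) * L = - y n" by (simp add: y_def)
  then show "0 \<le> p + (real (hv n) * \<beta> - of_int (kv n) * L)" "p + (real (hv n) * \<beta> - of_int (kv n) * L) < 1"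
    "\<bar>real (hv n) * \<beta> - of_int (kv n) * L\<bar> < r"
    using assms y_pos[of n] by auto
qed (use assms hv_pos in auto)

lemma return_right:
  assumes "0 \<le> p" "x n < r" "p + x n < 1"
  shows "return_time D r p \<in> {1..hu n}"
  unfolding return_time_LEAST
proof (rule rot.return_le)
  have "real (hu n) * \<beta> - of_int (ku n) * L = x n" by (simp add: x_def)
  then show "0 \<le> p + (real (hu n) * \<beta> - of_int (ku n) * L)" "p + (real (hu n) * \<beta> - of_int (ku n) * L) < 1"
    "\<bar>real (hu n) * \<beta> - of_int (ku n) * L\<bar> < r"
    using assms x_pos[of n] by auto
  show "p < 1" using assms x_pos[of n] by linarith
qed (use assms hu_pos in auto)

text \<open>Points in the left half have room to move right by less than \<open>1 / 2\<close>, the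
  others have room to move left.\<close>

lemma return_upper:
  assumes "p \<in> {0..<1}" "r \<le> 1 / 2" "x n < r" "y n < r"
  shows "return_time D r p \<in> {1..height n}"
  using return_left[of p n r] return_right[of p n r] assms
  by (cases "p < 1 / 2") (auto simp: height_def)

lemma moves_small:
  assumes "r > 0"
  shows "\<exists>n. x n < r \<and> y n < r"
proof -
  obtain k where k: "L / r < real k" using reals_Archimedean2 by blast
  have "real k \<le> real (height (Zt (4 * k)))"
    using height_unbounded[of k] by simp
  then have "L / r < real (height (Zt (4 * k)))" using k by linarith
  then have "L / height (Zt (4 * k)) < r"
    using assms height_pos[of "Zt (4 * k)"] by (simp add: field_simps)
  then show ?thesis
    using both_moves_bounds(1,2)[OF both_moves_blocks[of "4 * k"]] by (meson le_less_trans)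
qed

lemma return_lower:
  assumes p: "p \<in> {0..<1}" and r: "0 < r" "r \<le> 1 / 2" "r \<le> x n" "r \<le> y n"
  shows "height n \<le> 2 * return_time D r p"
proof -
  obtain i where "x i < r" "y i < r" using moves_small[OF r(1)] by blast
  then have i: "return_time D r p \<ge> 1" and "return_time D r p \<le> height i"
    using return_upper[OF p r(2)] by auto
  \<comment> \<open>\<open>return_ge\<close> requires a witness that some return closer than
    \<open>r\<close> exists; a late index \<open>i\<close> provides it.\<close>
  obtain j where "j \<ge> 1" "\<bar>(iet D ^^ j) p - p\<bar> < r"
  proof (cases "p < 1 / 2")
    case True
    have "\<exists>j\<ge>1. j \<le> hu i \<and> (iet D ^^ j) p = p + x i"
      using True p r \<open>x i < r\<close> x_pos[of i] hu_pos[of i]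
      by (intro rot.rotation_visit[of _ _ _ "ku i"]) (auto simp: x_def)
    then show ?thesis using that \<open>x i < r\<close> x_pos[of i] by fastforce
  next
    case False
    have "\<exists>j\<ge>1. j \<le> hv i \<and> (iet D ^^ j) p = p - y i"
      using False p r \<open>y i < r\<close> y_pos[of i] hv_pos[of i]
      by (intro rot.rotation_visit[of _ _ _ "kv i"]) (auto simp: y_def)
    then show ?thesis using that \<open>y i < r\<close> y_pos[of i] by fastforce
  qed
  moreover have "r \<le> \<bar>real k * \<beta> - of_int m * L\<bar>" if "1 \<le> k" "k < height n" for k m
    using farey_gap[OF state_facts(3) x_def x_pos y_def y_pos, of k n m] that r
    by (simp add: height_def)
  ultimately show ?thesis
    unfolding return_time_LEAST using p by (intro rot.return_ge) auto
qed

section \<open>The implications between the three conditions\<close>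

lemma log_return_ratio_eq:
  "log_return_ratio D = (\<lambda>r p. ln (real (return_time D r p)) / (- ln r))"
  by (intro ext) (simp add: log_return_ratio_def)

text \<open>By \<open>block_growth\<close> a block multiplies the height by at most one plus its
  length, and (Z) bounds this factor by a small power of the height.\<close>

lemma Z_imp_U:
  assumes "condition_Z D"
  shows "condition_U D"
  unfolding condition_U_def total log_return_ratio_eq
proof (rule uniform_return_exponent[where ?r0.0 = "1 / 2"])
  fix \<epsilon> :: real assume "\<epsilon> > 0"
  then obtain C where C: "C > 0"
    "\<And>k. k \<ge> 1 \<Longrightarrow> matrix_norm (Z_matrix D k (k + 1)) \<le> C * matrix_norm (Z_matrix D 0 k) powr \<epsilon>"
    using assms unfolding condition_Z_def by blast
  have "real (height (Zt (Suc k))) \<le> (C * 2 powr \<epsilon>) * real (height (Zt k)) powr (1 + \<epsilon>)" if "k \<ge> 1" for k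
  proof -
    let ?h = "real (height (Zt k))"
    have h: "?h \<ge> 1" using height_pos by simp
    have "1 + real (Zt (Suc k) - Zt k) \<le> C * matrix_norm (Z_matrix D 0 k) powr \<epsilon>"
      using C(2)[OF that] norm_Z_block[of k] by simp
    also have "\<dots> \<le> C * (2 * ?h) powr \<epsilon>"
      using C(1) norm_Z_0[of k] \<open>\<epsilon> > 0\<close> by (intro mult_left_mono powr_mono2) auto
    finally have len: "1 + real (Zt (Suc k) - Zt k) \<le> (C * 2 powr \<epsilon>) * ?h powr \<epsilon>"
      by (simp add: powr_mult)
    have "real (height (Zt (Suc k))) \<le> real ((1 + (Zt (Suc k) - Zt k)) * height (Zt k))"
      using block_growth[of k] by (rule of_nat_mono)
    also have "\<dots> = (1 + real (Zt (Suc k) - Zt k)) * ?h"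
      by (simp only: of_nat_mult of_nat_add of_nat_1)
    also have "\<dots> \<le> ((C * 2 powr \<epsilon>) * ?h powr \<epsilon>) * ?h"
      using len by (intro mult_right_mono) auto
    also have "\<dots> = (C * 2 powr \<epsilon>) * ?h powr (1 + \<epsilon>)"
      using h by (simp add: powr_add)
    finally show ?thesis .
  qed
  then show "\<exists>C>0. \<forall>k\<ge>1. real (height (Zt (Suc k))) \<le> C * real (height (Zt k)) powr (1 + \<epsilon>)"
    using C(1) by (intro exI[of _ "C * 2 powr \<epsilon>"]) auto
qed ((rule return_upper return_lower; assumption) | simp)+

lemma U_imp_R:
  assumes "condition_U D"
  shows "condition_R D"
  unfolding condition_R_def total
proof (rule AE_I2)
  fix p :: real
  assume "p \<in> space (lebesgue_on {0..<1})"
  then have "p \<in> {0..<1}" by simp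
  then show "((\<lambda>r. log_return_ratio D r p) \<longlongrightarrow> 1) (at_right 0)"
    using tendsto_uniform_limitI[OF assms[unfolded condition_U_def total]] by simp
qed

text \<open>One interior point with the limit suffices, and it exists because the open unit interval
  is not a null set. The point must be interior to leave room for returns on both sides.\<close>

lemma R_imp_Z:
  assumes "condition_R D"
  shows "condition_Z D"
proof -
  have "\<exists>p\<in>{0<..<1}. ((\<lambda>r. log_return_ratio D r p) \<longlongrightarrow> 1) (at_right 0)"
  proof (rule ccontr)
    assume none: "\<not> ?thesis"
    obtain N where N: "{p \<in> space (lebesgue_on {0..<1}). \<not> ((\<lambda>r. log_return_ratio D r p) \<longlongrightarrow> 1) (at_right 0)} \<subseteq> N"
      "emeasure (lebesgue_on {0..<1}) N = 0" "N \<in> sets (lebesgue_on {0..<1})"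
      using assms unfolding condition_R_def total by (rule AE_E)
    have "{0<..<1} \<subseteq> N"
    proof
      fix p :: real
      assume p: "p \<in> {0<..<1}"
      then have "p \<in> space (lebesgue_on {0..<1})" by simp
      then show "p \<in> N" using N(1) none p by blast
    qed
    then have "emeasure (lebesgue_on {0..<1}) {0<..<1::real} \<le> 0"
      using emeasure_mono[OF _ N(3)] N(2) by metis
    moreover have "emeasure (lebesgue_on {0..<1}) {0<..<1::real} = emeasure lebesgue {0<..<1::real}"
      by (rule emeasure_restrict_space) auto
    ultimately show False by simp
  qed
  then obtain p where p: "0 < p" "p < 1"
    and lim: "((\<lambda>r. ln (real (return_time D r p)) / (- ln r)) \<longlongrightarrow> 1) (at_right 0)"
    by (auto simp: log_return_ratio_eq)
  show ?thesis
    unfolding condition_Z_def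
  proof (intro allI impI)
    fix \<epsilon> :: real assume "\<epsilon> > 0"
    have "\<exists>C>0. \<forall>k. real (Zt (Suc k) - Zt k) \<le> C * real (height (Zt k)) powr \<epsilon>"
    proof (rule block_length_bound[OF \<open>\<epsilon> > 0\<close> _ lim])
      \<comment> \<open>Displacements below the distance from \<open>p\<close> to the ends of the
        interval keep the moved point inside.\<close>
      show "min p (1 - p) > 0" using p by simp
    qed (use p return_left[of p] return_right[of p] in \<open>auto simp del: atLeastAtMost_iff\<close>)
    then obtain C where C: "C > 0" "\<And>k. real (Zt (Suc k) - Zt k) \<le> C * real (height (Zt k)) powr \<epsilon>"
      by blast
    have "matrix_norm (Z_matrix D k (k + 1)) \<le> (4 * C * 2 powr \<epsilon>) * matrix_norm (Z_matrix D 0 k) powr \<epsilon>" for k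
    proof -
      \<comment> \<open>As a block has at least one step, the norm, 3 plus its length, is at most 4
        times its length.\<close>
      have "1 \<le> real (Zt (Suc k) - Zt k)" using z_less[of k] by simp
      then have "matrix_norm (Z_matrix D k (k + 1)) \<le> 4 * real (Zt (Suc k) - Zt k)"
        using norm_Z_block[of k] by simp
      also have "\<dots> \<le> 4 * (C * (2 * matrix_norm (Z_matrix D 0 k)) powr \<epsilon>)"
      proof -
        have "real (height (Zt k)) powr \<epsilon> \<le> (2 * matrix_norm (Z_matrix D 0 k)) powr \<epsilon>"
          using norm_Z_0(2)[of k] \<open>\<epsilon> > 0\<close> by (intro powr_mono2) auto
        then show ?thesis
          using C(2)[of k] C(1) by (smt (verit) mult_left_mono)
      qed
      also have "\<dots> = (4 * C * 2 powr \<epsilon>) * matrix_norm (Z_matrix D 0 k) powr \<epsilon>"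
        using norm_Z_0(2)[of k] by (simp add: powr_mult)
      finally show ?thesis .
    qed
    then show "\<exists>C>0. \<forall>k\<ge>1. matrix_norm (Z_matrix D k (k + 1)) \<le> C * matrix_norm (Z_matrix D 0 k) powr \<epsilon>"
      using C(1) by (intro exI[of _ "4 * C * 2 powr \<epsilon>"]) auto
  qed
qed

end

theorem mainTheorem5:
  fixes D :: "'a::finite iet_data"
  assumes "CARD('a) = 3"
    and "iet_data D"
    and "admissible D"
    and "keane D"
    and "total_len D = 1"
  shows "(condition_Z D \<longleftrightarrow> condition_U D) \<and> (condition_U D \<longleftrightarrow> condition_R D)"
proof -
  obtain s a b c where "has_shape s D a b c"
    using has_shape_exists[OF assms(1-3)] .
  then interpret keane_three_iet D s a b c
    using assms(4,5) by unfold_locales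
  show ?thesis
    using Z_imp_U U_imp_R R_imp_Z by blast
qed

end
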